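(* Let $p\ge2$ be an integer, $q=e^{i\pi/p}$, $U=\overline{\mathcal U}_qs\ell(2)$, and let $\mathscr D$ be the $U$-module algebra of quantum differential operators on the divided-power quantum plane. Let $\alpha\in\mathbb C$ be arbitrary and set $$\tau=-q^{\frac{p(p-1)}2+1}\sum_{i=1}^{p}a_i\,x^{(p-i)}y^{(i-1)}\partial_x^{p-i}\partial_y^{i-1},\qquad a_i=\alpha+\sum_{j=2}^{i}\frac{q^{1-j}}{[j-1]},$$ $\lambda_i=E^i\tau$ and $\rho_i=F^i\tau$ for $1\le i\le p-1$, and $\beta=F\lambda_1$. Then $\beta=F\lambda_1=E\rho_1$, and the span of $\tau,\lambda_1,\dots,\lambda_{p-1},\rho_1,\dots,\rho_{p-1},\beta$ is a $U$-submodule of $\mathscr D$ isomorphic to the projective module $\mathscr P^+_1$ (the projective cover of the trivial one-dimensional $U$-module). In it, for $1\le i\le p-2$, $F\lambda_{i+1}$ is a nonzero multiple of $\lambda_i$ and $E\rho_{i+1}$ is a nonzero multiple of $\rho_i$. Moreover, $$\lambda_1=q^{\frac{p(p-1)}2}\sum_{i=1}^{p-1}q^{i+2}x^{(p-i)}y^{(i-1)}\partial_x^{p-i-1}\partial_y^{i},\qquad \lambda_{p-1}=(-1)^{p-1}[p-1]!\,q^{\frac{p(p-1)}2+1}x^{(p-1)}\partial_y^{p-1},$$ $$\rho_1=-q^{\frac{p(p-1)}2}\sum_{i=1}^{p-1}q^{i+1}x^{(i-1)}y^{(p-i)}\partial_x^{i}\partial_y^{p-1-i},\qquad \rho_{p-1}=-[p-1]!\,q^{\frac{p(p-1)}2+2}y^{(p-1)}\partial_x^{p-1},$$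 $$\beta=-q^{\frac{p(p-1)}2+1}\sum_{i=1}^{p}x^{(p-i)}y^{(i-1)}\partial_x^{p-i}\partial_y^{i-1}.$$
   Context: Notation: $[n]=\frac{q^n-q^{-n}}{q-q^{-1}}$, $[n]!=[1][2]\cdots[n]$, and $\left[{m\atop n}\right]$ is the $q$-binomial coefficient $\frac{[m]!}{[m-n]!\,[n]!}$, understood as the value at $q=e^{i\pi/p}$ of the corresponding Laurent polynomial in a generic parameter; $q^{p(p-1)/2}=i^{\,p-1}$ with $i=\sqrt{-1}$. Quantum group $U=\overline{\mathcal U}_{q}s\ell(2)$: the $\mathbb C$-algebra generated by $E,F,K^{\pm1}$ with relations $KEK^{-1}=q^2E$, $KFK^{-1}=q^{-2}F$, $[E,F]=\frac{K-K^{-1}}{q-q^{-1}}$, $E^p=F^p=0$, $K^{2p}=1$, with Hopf algebra structure $\Delta(E)=E\otimes K+1\otimes E$, $\Delta(K)=K\otimes K$, $\Delta(F)=F\otimes1+K^{-1}\otimes F$, $\epsilon(E)=\epsilon(F)=0$, $\epsilon(K)=1$. A $U$-module algebra is an associative algebra with a $U$-action such that $h(uv)=\sum(h'u)(h''v)$ where $\Delta(h)=\sum h'\otimes h''$, and $h(1)=\epsilon(h)1$. Divided-power quantum plane $A=\underline{\mathbb C}_q[x,y]$: the associative algebra with basis $x^{(m)}y^{(n)}$, $m,n\ge0$ ($x^{(0)}=y^{(0)}=1$), and multiplication determined by $x^{(m)}x^{(n)}=\left[{m+n\atop m}\right]x^{(m+n)}$, $y^{(m)}y^{(n)}=\left[{m+n\atop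 m}\right]y^{(m+n)}$, $y^{(n)}x^{(m)}=q^{nm}x^{(m)}y^{(n)}$; $x^{(m)}=y^{(m)}=0$ for $m<0$. It is a $U$-module algebra with $E(x^{(m)}y^{(n)})=[m+1]x^{(m+1)}y^{(n-1)}$, $K(x^{(m)}y^{(n)})=q^{m-n}x^{(m)}y^{(n)}$, $F(x^{(m)}y^{(n)})=[n+1]x^{(m-1)}y^{(n+1)}$. Quantum derivatives $\partial_x,\partial_y:A\to A$ are the linear maps $\partial_x(x^{(m)}y^{(n)})=q^{-m-2n+1}x^{(m-1)}y^{(n)}$, $\partial_y(x^{(m)}y^{(n)})=q^{-m-n+1}x^{(m)}y^{(n-1)}$; they satisfy $\partial_x\partial_y=q\,\partial_y\partial_x$. $\mathscr D$ is the algebra of operators on $A$ spanned by $x^{(m)}y^{(n)}\partial_x^a\partial_y^b$, $m,n,a,b\ge0$ (elements of $A$ acting by left multiplication). It is a $U$-module algebra with the action on elements of $A$ given by $E(x^{(m)}y^{(n)})=[m+1]x^{(m+1)}y^{(n-1)}$, $K(x^{(m)}y^{(n)})=q^{m-n}x^{(m)}y^{(n)}$, $F(x^{(m)}y^{(n)})=[n+1]x^{(m-1)}y^{(n+1)}$, and with $E\partial_x=-q\partial_y$, $E\partial_y=0$, $K\partial_x=q^{-1}\partial_x$, $K\partial_y=q\partial_y$, $F\partial_x=0$, $F\partial_y=-q^{-1}\partial_x$, extended to products by $h(uv)=\sum(h'u)(h''v)$. *)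

theory Defs
  imports
    Complex_Main
    "HOL-Computational_Algebra.Formal_Laurent_Series"
    "HOL-Library.Poly_Mapping"
    "HOL-Library.Function_Algebras"
begin

section \<open>q-numbers at the root of unity\<close>

definition qroot :: "nat \<Rightarrow> complex" where
  "qroot p = exp (\<i> * of_real pi / of_nat p)"

definition qint :: "nat \<Rightarrow> nat \<Rightarrow> complex" where
  "qint p n = (qroot p ^ n - inverse (qroot p) ^ n) / (qroot p - inverse (qroot p))"

definition qfact :: "nat \<Rightarrow> nat \<Rightarrow> complex" where
  "qfact p n = (\<Prod>j=1..n. qint p j)"

text \<open>
  Since \<open>[p] = 0\<close>, the quotient of q-factorials makes no sense at the root of unity.  It is
  therefore formed in the field of Laurent series in a generic parameter, where it is a Laurent
  polynomial, and that Laurent polynomial is then evaluated.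
\<close>

definition gen_qint :: "nat \<Rightarrow> complex fls" where
  "gen_qint n = (fls_X ^ n - fls_X_inv ^ n) / (fls_X - fls_X_inv)"

definition gen_qfact :: "nat \<Rightarrow> complex fls" where
  "gen_qfact n = (\<Prod>j=1..n. gen_qint j)"

definition gen_qbinom :: "nat \<Rightarrow> nat \<Rightarrow> complex fls" where
  "gen_qbinom m n = gen_qfact m / (gen_qfact (m - n) * gen_qfact n)"

definition laurent_eval :: "complex fls \<Rightarrow> complex \<Rightarrow> complex" where
  "laurent_eval f z = (\<Sum>k | fls_nth f k \<noteq> 0. fls_nth f k * z powi k)"

definition qbinom :: "nat \<Rightarrow> nat \<Rightarrow> nat \<Rightarrow> complex" where
  "qbinom p m n = laurent_eval (gen_qbinom m n) (qroot p)"


section \<open>Modules and module algebras over the restricted quantum group\<close>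

text \<open>
  A module over the algebra presented by the generators \<open>E\<close>, \<open>F\<close>, \<open>K\<close>, \<open>K\<^sup>-\<^sup>1\<close> is a vector
  space with four operators that satisfy the defining relations.  The vector space is a subspace
  (\<open>carr\<close>) of a complex vector space, given by a type with a scalar multiplication (\<open>scl\<close>);
  nothing is assumed about the operators outside \<open>carr\<close>.
\<close>

record 'v umod =
  scl :: "complex \<Rightarrow> 'v \<Rightarrow> 'v"
  carr :: "'v set"
  actE :: "'v \<Rightarrow> 'v"
  actF :: "'v \<Rightarrow> 'v"
  actK :: "'v \<Rightarrow> 'v"
  actKi :: "'v \<Rightarrow> 'v"

definition umod_linear :: "'a::ab_group_add umod \<Rightarrow> 'b::ab_group_add umod \<Rightarrow> ('a \<Rightarrow> 'b) \<Rightarrow> bool" where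
  "umod_linear M N f \<longleftrightarrow>
     (\<forall>u\<in>carr M. f u \<in> carr N) \<and>
     (\<forall>u\<in>carr M. \<forall>v\<in>carr M. f (u + v) = f u + f v) \<and>
     (\<forall>c. \<forall>u\<in>carr M. f (scl M c u) = scl N c (f u))"

definition u_module :: "nat \<Rightarrow> 'v::ab_group_add umod \<Rightarrow> bool" where
  "u_module p M \<longleftrightarrow>
     vector_space (scl M) \<and> module.subspace (scl M) (carr M) \<and>
     umod_linear M M (actE M) \<and> umod_linear M M (actF M) \<and>
     umod_linear M M (actK M) \<and> umod_linear M M (actKi M) \<and>
     (\<forall>v\<in>carr M.
        actK M (actKi M v) = v \<and>
        actKi M (actK M v) = v \<and>
        actK M (actE M (actKi M v)) = scl M (qroot p ^ 2) (actE M v) \<and>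
        actK M (actF M (actKi M v)) = scl M (inverse (qroot p) ^ 2) (actF M v) \<and>
        actE M (actF M v) - actF M (actE M v) =
          scl M (1 / (qroot p - inverse (qroot p))) (actK M v - actKi M v) \<and>
        (actE M ^^ p) v = 0 \<and>
        (actF M ^^ p) v = 0 \<and>
        (actK M ^^ (2 * p)) v = v)"

definition u_submodule :: "'v::ab_group_add umod \<Rightarrow> 'v set \<Rightarrow> bool" where
  "u_submodule M W \<longleftrightarrow>
     module.subspace (scl M) W \<and> W \<subseteq> carr M \<and>
     (\<forall>w\<in>W. actE M w \<in> W \<and> actF M w \<in> W \<and> actK M w \<in> W \<and> actKi M w \<in> W)"

definition umod_hom :: "'a::ab_group_add umod \<Rightarrow> 'b::ab_group_add umod \<Rightarrow> ('a \<Rightarrow> 'b) \<Rightarrow> bool" where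
  "umod_hom M N f \<longleftrightarrow>
     umod_linear M N f \<and>
     (\<forall>v\<in>carr M. f (actE M v) = actE N (f v) \<and> f (actF M v) = actF N (f v) \<and>
                 f (actK M v) = actK N (f v) \<and> f (actKi M v) = actKi N (f v))"

definition umod_isomorphic :: "'a::ab_group_add umod \<Rightarrow> 'b::ab_group_add umod \<Rightarrow> bool" where
  "umod_isomorphic M N \<longleftrightarrow> (\<exists>f. umod_hom M N f \<and> bij_betw f (carr M) (carr N))"

text \<open>
  The lifting property involves modules over arbitrary types, over which a definition cannot
  quantify.  The types are explicit parameters; a theorem that leaves them as type variables
  asserts the lifting property for all modules.
\<close>

definition projective_umod ::
    "'m::ab_group_add itself \<Rightarrow> 'n::ab_group_add itself \<Rightarrow> nat \<Rightarrow> 'a::ab_group_add umod \<Rightarrow> bool" where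
  "projective_umod _ _ p P \<longleftrightarrow>
     u_module p P \<and>
     (\<forall>(M :: 'm umod) (N :: 'n umod) g f.
        u_module p M \<and> u_module p N \<and> umod_hom M N g \<and> g ` carr M = carr N \<and> umod_hom P N f
        \<longrightarrow> (\<exists>h. umod_hom P M h \<and> (\<forall>v\<in>carr P. g (h v) = f v)))"

definition projective_cover ::
    "'m::ab_group_add itself \<Rightarrow> 'n::ab_group_add itself \<Rightarrow> nat \<Rightarrow>
     'a::ab_group_add umod \<Rightarrow> 'b::ab_group_add umod \<Rightarrow> bool" where
  "projective_cover TM TN p P T \<longleftrightarrow>
     projective_umod TM TN p P \<and> u_module p T \<and>
     (\<exists>\<pi>. umod_hom P T \<pi> \<and> \<pi> ` carr P = carr T \<and>
        (\<forall>W. u_submodule P W \<and> {w + k | w k. w \<in> W \<and> k \<in> carr P \<and> \<pi> k = 0} = carr P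
             \<longrightarrow> W = carr P))"

text \<open>The trivial module, on which the quantum group acts by the counit.\<close>

definition trivial_umod :: "complex umod" where
  "trivial_umod = \<lparr>scl = (*), carr = UNIV, actE = (\<lambda>_. 0), actF = (\<lambda>_. 0),
                   actK = (\<lambda>z. z), actKi = (\<lambda>z. z)\<rparr>"

text \<open>
  The compatibility with the coproduct and the counit is required for the generators only: both
  are algebra homomorphisms, so it extends to the whole quantum group.
\<close>

definition u_module_algebra ::
    "nat \<Rightarrow> 'v::ab_group_add umod \<Rightarrow> ('v \<Rightarrow> 'v \<Rightarrow> 'v) \<Rightarrow> 'v \<Rightarrow> bool" where
  "u_module_algebra p M mul e \<longleftrightarrow>
     u_module p M \<and>
     e \<in> carr M \<and> (\<forall>u\<in>carr M. mul e u = u \<and> mul u e = u) \<and>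
     (\<forall>u\<in>carr M. umod_linear M M (mul u)) \<and>
     (\<forall>v\<in>carr M. umod_linear M M (\<lambda>u. mul u v)) \<and>
     (\<forall>u\<in>carr M. \<forall>v\<in>carr M. \<forall>w\<in>carr M. mul (mul u v) w = mul u (mul v w)) \<and>
     (\<forall>u\<in>carr M. \<forall>v\<in>carr M.
        actE M (mul u v) = mul (actE M u) (actK M v) + mul u (actE M v) \<and>
        actF M (mul u v) = mul (actF M u) v + mul (actKi M u) (actF M v) \<and>
        actK M (mul u v) = mul (actK M u) (actK M v) \<and>
        actKi M (mul u v) = mul (actKi M u) (actKi M v)) \<and>
     actE M e = 0 \<and> actF M e = 0 \<and> actK M e = e \<and> actKi M e = e"


section \<open>The divided-power quantum plane\<close>

text \<open>
  A finitely supported \<open>u\<close> stands for the sum of the \<open>lookup u (m, n)\<close>-multiples of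
  \<open>x\<^sup>(\<^sup>m\<^sup>) y\<^sup>(\<^sup>n\<^sup>)\<close>.  Only the vector space structure of the type is used; the product is
  \<open>qmult\<close>, not the convolution product \<open>(*)\<close> of \<open>poly_mapping\<close>.
\<close>

type_synonym qplane = "(nat \<times> nat) \<Rightarrow>\<^sub>0 complex"

definition qscale :: "complex \<Rightarrow> qplane \<Rightarrow> qplane" where
  "qscale c u = Poly_Mapping.map ((*) c) u"

definition qxy :: "nat \<Rightarrow> nat \<Rightarrow> qplane" where
  "qxy m n = Poly_Mapping.single (m, n) 1"

text \<open>The linear extension of a map that is given on the basis.\<close>

definition qlinext :: "(nat \<Rightarrow> nat \<Rightarrow> qplane) \<Rightarrow> qplane \<Rightarrow> qplane" where
  "qlinext \<phi> u =
     (\<Sum>k\<in>Poly_Mapping.keys u. qscale (Poly_Mapping.lookup u k) (\<phi> (fst k) (snd k)))"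

text \<open>
  On the basis, \<open>x\<^sup>(\<^sup>m\<^sup>) y\<^sup>(\<^sup>n\<^sup>) \<cdot> x\<^sup>(\<^sup>r\<^sup>) y\<^sup>(\<^sup>s\<^sup>) = q\<^sup>n\<^sup>r x\<^sup>(\<^sup>m\<^sup>) x\<^sup>(\<^sup>r\<^sup>) y\<^sup>(\<^sup>n\<^sup>) y\<^sup>(\<^sup>s\<^sup>)\<close> by the
  commutation rule for \<open>y\<^sup>(\<^sup>n\<^sup>)\<close> and \<open>x\<^sup>(\<^sup>r\<^sup>)\<close>.
\<close>

definition qmult :: "nat \<Rightarrow> qplane \<Rightarrow> qplane \<Rightarrow> qplane" where
  "qmult p u v =
     qlinext (\<lambda>m n. qlinext (\<lambda>r s.
       qscale (qroot p ^ (n * r) * qbinom p (m + r) m * qbinom p (n + s) n)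
         (qxy (m + r) (n + s))) v) u"

definition planeE :: "nat \<Rightarrow> qplane \<Rightarrow> qplane" where
  "planeE p = qlinext (\<lambda>m n. if n = 0 then 0 else qscale (qint p (m + 1)) (qxy (m + 1) (n - 1)))"

definition planeF :: "nat \<Rightarrow> qplane \<Rightarrow> qplane" where
  "planeF p = qlinext (\<lambda>m n. if m = 0 then 0 else qscale (qint p (n + 1)) (qxy (m - 1) (n + 1)))"

definition planeK :: "nat \<Rightarrow> qplane \<Rightarrow> qplane" where
  "planeK p = qlinext (\<lambda>m n. qscale (qroot p powi (int m - int n)) (qxy m n))"


section \<open>Quantum differential operators\<close>

type_synonym qop = "qplane \<Rightarrow> qplane"

definition opscale :: "complex \<Rightarrow> qop \<Rightarrow> qop" where
  "opscale c T = (\<lambda>u. qscale c (T u))"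

definition dx :: "nat \<Rightarrow> qop" where
  "dx p = qlinext (\<lambda>m n. if m = 0 then 0
     else qscale (qroot p powi (- int m - 2 * int n + 1)) (qxy (m - 1) n))"

definition dy :: "nat \<Rightarrow> qop" where
  "dy p = qlinext (\<lambda>m n. if n = 0 then 0
     else qscale (qroot p powi (- int m - int n + 1)) (qxy m (n - 1)))"

text \<open>The operator \<open>x\<^sup>(\<^sup>m\<^sup>) y\<^sup>(\<^sup>n\<^sup>) \<partial>\<^sub>x\<^sup>a \<partial>\<^sub>y\<^sup>b\<close>.\<close>

definition qmon :: "nat \<Rightarrow> nat \<Rightarrow> nat \<Rightarrow> nat \<Rightarrow> nat \<Rightarrow> qop" where
  "qmon p m n a b = qmult p (qxy m n) \<circ> (dx p ^^ a) \<circ> (dy p ^^ b)"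

definition qdiffops :: "nat \<Rightarrow> qop set" where
  "qdiffops p = module.span opscale {qmon p m n a b | m n a b. True}"

text \<open>
  The algebra of quantum differential operators with its structure of a module algebra.  The
  action is determined by its values on the elements of the quantum plane (as multiplication
  operators) and on the two derivatives, because these generate the algebra.  It exists: it is the
  adjoint action \<open>h \<cdot> T = \<Sum> h' \<circ> T \<circ> S(h'')\<close>, that is \<open>E \<cdot> T = (E T - T E) K\<^sup>-\<^sup>1\<close>,
  \<open>F \<cdot> T = F T - K\<^sup>-\<^sup>1 T K F\<close>, \<open>K \<cdot> T = K T K\<^sup>-\<^sup>1\<close>.
\<close>

definition is_qdiff_module_algebra :: "nat \<Rightarrow> qop umod \<Rightarrow> bool" where
  "is_qdiff_module_algebra p D \<longleftrightarrow>
     scl D = opscale \<and> carr D = qdiffops p \<and>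
     u_module_algebra p D (\<circ>) id \<and>
     (\<forall>m n. actE D (qmult p (qxy m n)) = qmult p (planeE p (qxy m n)) \<and>
            actF D (qmult p (qxy m n)) = qmult p (planeF p (qxy m n)) \<and>
            actK D (qmult p (qxy m n)) = qmult p (planeK p (qxy m n))) \<and>
     actE D (dx p) = opscale (- qroot p) (dy p) \<and>
     actE D (dy p) = 0 \<and>
     actK D (dx p) = opscale (inverse (qroot p)) (dx p) \<and>
     actK D (dy p) = opscale (qroot p) (dy p) \<and>
     actF D (dx p) = 0 \<and>
     actF D (dy p) = opscale (- inverse (qroot p)) (dx p)"

definition acoeff :: "nat \<Rightarrow> complex \<Rightarrow> nat \<Rightarrow> complex" where
  "acoeff p \<alpha> i = \<alpha> + (\<Sum>j=2..i. qroot p powi (1 - int j) / qint p (j - 1))"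

end

theory Submission
  imports Defs
begin

text \<open>
  On vectors of weight 1 the operator \<open>FE\<close> is a shifted Casimir element \<open>C\<close>, and
  \<open>F\<^sup>n E\<^sup>n = \<Prod>\<^sub>i\<^sub><\<^sub>n (C - [i][i+1])\<close>.  For \<open>n = p\<close> both the first and the last factor are \<open>C\<close>, so
  \<open>E\<^sup>p = 0\<close> gives \<open>C\<^sup>2 \<Prod>\<^sub>0\<^sub><\<^sub>i\<^sub><\<^sub>p\<^sub>-\<^sub>1 (C - [i][i+1]) = 0\<close> with nonzero constants \<open>[i][i+1]\<close>.  Hence in any module every
  weight vector of weight 1 can be corrected, by a polynomial in \<open>C\<close> that is 1 modulo \<open>C\<^sup>2\<close>, to one
  that \<open>C\<^sup>2\<close> kills.  The vectors \<open>v\<close> of weight 1 with \<open>C\<^sup>2 v = 0\<close> satisfy all the relations of the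
  top of \<open>\<P>\<^sup>+\<^sub>1\<close>: the \<open>2p\<close> vectors \<open>E\<^sup>i v\<close>, \<open>F\<^sup>i v\<close>, \<open>F E v\<close> span a submodule with known structure
  constants, and they are independent as soon as \<open>F E v \<noteq> 0\<close>.  This is the lifting property, and it
  reduces the theorem to computing \<open>E\<^sup>i \<tau>\<close>, \<open>F\<^sup>i \<tau>\<close> and \<open>F E \<tau>\<close> from the action on monomials.
\<close>

section \<open>q-numbers\<close>

text \<open>The quantum group itself is not constructed, only its modules, so projectivity cannot be
  read off from a direct summand of the regular module and is proved as a lifting property. This is
  feasible because the ladder has the same structure constants in every module: lifting a
  homomorphism is lifting one vector. The square of \<open>C\<close> is essential, since a vector
  killed by \<open>C\<close> alone has \<open>F E v = 0\<close>. Symmetry between E and F halves all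
  computations.

  For the differential operators, independence of the 2p vectors is a consequence of module theory
  once \<beta> is known to be a nonzero operator; it does not rest on independence of monomials. The
  coefficients of \<tau> are a discrete primitive: on weight 1, E turns coefficients s_i into
  multiples of [i] (s_i - s_(i+1)). Constant coefficients give \<beta>, which E and F kill, and
  \<alpha> is the constant of summation: changing it adds a multiple of \<beta> to \<tau>.\<close>

lemma qroot_eq_cis: "qroot p = cis (pi / real p)"
  by (simp add: qroot_def cis_conv_exp)

lemma qroot_nonzero [simp]: "qroot p \<noteq> 0"
  by (simp add: qroot_def)

lemma inverse_qroot: "inverse (qroot p) = cis (- (pi / real p))"
  by (simp add: qroot_eq_cis cis_inverse)

lemma qroot_power_p: "p > 0 \<Longrightarrow> qroot p ^ p = - 1"
  by (simp add: qroot_eq_cis DeMoivre)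

lemma qroot_power_diff: "qroot p ^ n - inverse (qroot p) ^ n = 2 * \<i> * sin (pi * n / p)"
  by (simp only: inverse_qroot) (simp add: qroot_eq_cis DeMoivre complex_eq_iff mult.commute)

lemma qroot_diff_nonzero:
  assumes "p \<ge> 2"
  shows "qroot p - inverse (qroot p) \<noteq> 0"
proof -
  have "sin (pi / p) > 0"
    using assms by (intro sin_gt_zero) (auto simp: field_simps)
  then show ?thesis
    using qroot_power_diff[of p 1] by simp
qed

text \<open>[n] = sin(pi n / p) / sin(pi / p), and the sine is positive strictly between 0 and
  pi.\<close>

lemma qint_nonzero:
  assumes "0 < n" "n < p"
  shows "qint p n \<noteq> 0"
proof -
  have "sin (pi * n / p) > 0"
    using assms by (intro sin_gt_zero) (auto simp: field_simps)
  then show ?thesis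
    using qroot_power_diff[of p n] qroot_diff_nonzero[of p] assms by (simp add: qint_def)
qed

lemma qint_0 [simp]: "qint p 0 = 0"
  by (simp add: qint_def)

lemma qint_1: "p \<ge> 2 \<Longrightarrow> qint p (Suc 0) = 1"
  using qroot_diff_nonzero[of p] by (simp add: qint_def)

lemma qint_p: "p > 0 \<Longrightarrow> qint p p = 0"
  using qroot_power_p[of p] by (simp add: qint_def power_inverse)

lemma qint_powi:
  "qint p n = (qroot p powi int n - qroot p powi (- int n)) / (qroot p - inverse (qroot p))"
  by (simp add: qint_def power_int_minus power_inverse)

text \<open>As q^p = -1, passing from n to p - n interchanges q^n and q^(-n) up to a common
  sign.\<close>

lemma qint_reflect:
  assumes "n \<le> p" "p > 0"
  shows "qint p (p - n) = qint p n"
proof -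
  have "qroot p powi int (p - n) = - (qroot p powi (- int n))"
    using assms by (simp add: of_nat_diff power_int_diff power_int_minus qroot_power_p divide_inverse)
  moreover from this have "qroot p powi (- int (p - n)) = - (qroot p powi int n)"
    by (simp only: power_int_minus) (simp add: power_int_minus)
  ultimately show ?thesis
    by (simp only: qint_powi) simp
qed

lemma qint_add:
  "qint p (m + n) = qroot p ^ n * qint p m + inverse (qroot p) ^ m * qint p n"
  by (simp add: qint_def power_add add_divide_distrib [symmetric] algebra_simps)

lemma qint_add':
  "qint p (m + n) = inverse (qroot p) ^ n * qint p m + qroot p ^ m * qint p n"
  by (simp add: qint_def power_add add_divide_distrib [symmetric] algebra_simps)

text \<open>[i+2] - [i] = q^(i+1) + q^(-i-1), and multiplying this by [i+1] gives [2(i+1)]. This is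
  the increment of the constants [n][n+1] when F moves past one more E.\<close>

lemma qint_Suc_mult_Suc_Suc:
  assumes "p \<ge> 2"
  shows "qint p (Suc i) * qint p (Suc (Suc i)) =
    qint p i * qint p (Suc i) + qint p (2 * Suc i)"
proof -
  let ?q = "qroot p"
  have "qint p (Suc (Suc i)) = ?q ^ Suc i + inverse ?q * qint p (Suc i)"
    using qint_add[of p 1 "Suc i"] assms by (simp add: qint_1)
  moreover have "qint p (Suc i) = ?q ^ i + inverse ?q * qint p i"
    using qint_add[of p 1 i] assms by (simp add: qint_1)
  moreover have "qint p (Suc i) = inverse ?q ^ i + ?q * qint p i"
    using qint_add[of p i 1] assms by (simp add: qint_1 algebra_simps)
  moreover have "qint p (2 * Suc i) = (?q ^ Suc i + inverse ?q ^ Suc i) * qint p (Suc i)"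
    using qint_add[of p "Suc i" "Suc i"] by (simp only: mult_2 distrib_right)
  ultimately show ?thesis
    by (smt (verit) add.commute add.left_commute distrib_left left_inverse mult.assoc mult.commute
        mult.left_neutral power_Suc qroot_nonzero)
qed

section \<open>Modules over the restricted quantum group\<close>

locale umodule =
  fixes p :: nat and M :: "'v::ab_group_add umod"
  assumes p_ge_2: "2 \<le> p" and u_module: "u_module p M"
begin

sublocale vs: vector_space "scl M"
  using u_module by (simp add: u_module_def)

abbreviation "q \<equiv> qroot p"
abbreviation "E \<equiv> actE M"
abbreviation "F \<equiv> actF M"
abbreviation "K \<equiv> actK M"
abbreviation "Ki \<equiv> actKi M"

lemma subspace_carr: "vs.subspace (carr M)"
  using u_module by (simp add: u_module_def)

lemmas carr_0 [simp, intro] = vs.subspace_0[OF subspace_carr]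
  and carr_add [simp, intro] = vs.subspace_add[OF subspace_carr]
  and carr_diff [simp, intro] = vs.subspace_diff[OF subspace_carr]
  and carr_scale [simp, intro] = vs.subspace_scale[OF subspace_carr]
  and carr_sum = vs.subspace_sum[OF subspace_carr]

lemma umod_linear_act: "umod_linear M M E" "umod_linear M M F" "umod_linear M M K" "umod_linear M M Ki"
  using u_module by (simp_all add: u_module_def)

lemma act_carr [simp, intro]:
  assumes "v \<in> carr M"
  shows "E v \<in> carr M" "F v \<in> carr M" "K v \<in> carr M" "Ki v \<in> carr M"
  using umod_linear_act assms by (simp_all add: umod_linear_def)

lemma act_pow_carr [simp, intro]:
  assumes "v \<in> carr M"
  shows "(E ^^ n) v \<in> carr M" "(F ^^ n) v \<in> carr M" "(K ^^ n) v \<in> carr M"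
  using assms by (induction n) simp_all

lemma relations:
  assumes "v \<in> carr M"
  shows "K (Ki v) = v" "Ki (K v) = v"
    "K (E (Ki v)) = scl M (q ^ 2) (E v)" "K (F (Ki v)) = scl M (inverse q ^ 2) (F v)"
    "E (F v) - F (E v) = scl M (1 / (q - inverse q)) (K v - Ki v)"
    "(E ^^ p) v = 0" "(F ^^ p) v = 0" "(K ^^ (2 * p)) v = v"
  using u_module assms by (simp_all add: u_module_def)

end

lemma umod_linear_carr: "umod_linear M N f \<Longrightarrow> u \<in> carr M \<Longrightarrow> f u \<in> carr N"
  and umod_linear_add: "umod_linear M N f \<Longrightarrow> u \<in> carr M \<Longrightarrow> v \<in> carr M \<Longrightarrow> f (u + v) = f u + f v"
  and umod_linear_scale: "umod_linear M N f \<Longrightarrow> u \<in> carr M \<Longrightarrow> f (scl M c u) = scl N c (f u)"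
  by (simp_all add: umod_linear_def)

lemma umod_linear_compose:
  "umod_linear M N f \<Longrightarrow> umod_linear N L g \<Longrightarrow> umod_linear M L (\<lambda>v. g (f v))"
  by (simp add: umod_linear_def)

context umodule
begin

lemma umod_linear_0:
  assumes "umod_linear M N f"
  shows "f 0 = 0"
  using umod_linear_add[OF assms, of 0 0] by simp

lemma umod_linear_diff:
  assumes "umod_linear M N f" "u \<in> carr M" "v \<in> carr M"
  shows "f (u - v) = f u - f v"
  using umod_linear_add[OF assms(1), of "u - v" v] assms by simp

lemma umod_linear_sum:
  assumes "umod_linear M N f" "\<And>i. i \<in> A \<Longrightarrow> x i \<in> carr M"
  shows "f (\<Sum>i\<in>A. x i) = (\<Sum>i\<in>A. f (x i))"
  using assms(2)
proof (induction A rule: infinite_finite_induct)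
  case (insert a A)
  then show ?case
    using umod_linear_add[OF assms(1), of "x a" "sum x A"] by (simp add: carr_sum)
qed (simp_all add: umod_linear_0[OF assms(1)])

lemmas act_0 [simp] = umod_linear_act[THEN umod_linear_0]
lemmas act_diff = umod_linear_act[THEN umod_linear_diff]
lemmas act_scale = umod_linear_act[THEN umod_linear_scale]
lemmas act_sum = umod_linear_act[THEN umod_linear_sum]

lemma umod_linear_pow: "umod_linear M M f \<Longrightarrow> umod_linear M M (f ^^ n)"
  by (induction n) (simp add: umod_linear_def, simp add: umod_linear_compose o_def)

lemma umod_linear_act_pow: "umod_linear M M (E ^^ n)" "umod_linear M M (F ^^ n)"
  "umod_linear M M (K ^^ n)"
  by (simp_all add: umod_linear_pow umod_linear_act)

lemma act_pow_0 [simp]: "(E ^^ n) 0 = 0" "(F ^^ n) 0 = 0"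
  by (simp_all add: umod_linear_act_pow[THEN umod_linear_0])

lemma E_pow_ge_p:
  assumes "v \<in> carr M" "n \<ge> p"
  shows "(E ^^ n) v = 0"
proof -
  have "(E ^^ (n - p + p)) v = 0"
    unfolding funpow_add using assms by (simp add: relations)
  then show ?thesis
    using assms by simp
qed

lemma K_E: "v \<in> carr M \<Longrightarrow> K (E v) = scl M (q ^ 2) (E (K v))"
  using relations(3)[of "K v"] by (simp add: relations)

lemma Ki_eigen:
  assumes "v \<in> carr M" "K v = scl M z v" "z \<noteq> 0"
  shows "Ki v = scl M (inverse z) v"
proof -
  have "v = scl M z (Ki v)"
    using assms relations(2)[of v] by (simp add: act_scale)
  then have "scl M (inverse z) v = scl M (inverse z) (scl M z (Ki v))"
    by simp
  then show ?thesis
    using assms by simp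
qed

lemma K_E_pow:
  assumes "v \<in> carr M" "K v = v"
  shows "K ((E ^^ n) v) = scl M (q ^ (2 * n)) ((E ^^ n) v)"
proof (induction n)
  case (Suc n)
  then show ?case
    using assms by (simp add: K_E act_scale power2_eq_square mult.commute)
qed (use assms in simp)

lemma Ki_E_pow:
  assumes "v \<in> carr M" "K v = v"
  shows "Ki ((E ^^ n) v) = scl M (inverse (q ^ (2 * n))) ((E ^^ n) v)"
  using assms by (intro Ki_eigen K_E_pow) simp_all

text \<open>On weight q^(2n) the commutator of E and F is the scalar (q^(2n) - q^(-2n)) / (q -
  q^(-1)).\<close>

lemma E_F:
  assumes "v \<in> carr M" "K v = v"
  shows "E (F ((E ^^ n) v)) = F (E ((E ^^ n) v)) + scl M (qint p (2 * n)) ((E ^^ n) v)"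
proof -
  have "E (F ((E ^^ n) v)) - F (E ((E ^^ n) v)) =
      scl M (1 / (q - inverse q)) (scl M (q ^ (2 * n)) ((E ^^ n) v) -
        scl M (inverse (q ^ (2 * n))) ((E ^^ n) v))"
    using relations(5)[of "(E ^^ n) v"] assms by (simp add: K_E_pow Ki_E_pow)
  also have "\<dots> = scl M (qint p (2 * n)) ((E ^^ n) v)"
    by (simp add: vs.scale_left_diff_distrib [symmetric] vs.scale_right_diff_distrib [symmetric]
        qint_def power_inverse)
  finally show ?thesis
    by (simp add: algebra_simps)
qed

lemma EF_eq_FE:
  assumes "v \<in> carr M" "K v = v"
  shows "E (F v) = F (E v)"
  using E_F[OF assms, of 0] by simp

lemma K_FE:
  assumes "v \<in> carr M" "K v = v"
  shows "K (F (E v)) = F (E v)"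
proof -
  have "K (F (E v)) = scl M (inverse q ^ 2) (F (K (E v)))"
    using relations(4)[of "K (E v)"] assms by (simp add: relations)
  also have "\<dots> = F (E v)"
    using assms by (simp add: K_E act_scale flip: power_mult_distrib)
  finally show ?thesis .
qed

text \<open>On vectors of weight 1 the operator \<open>FE\<close> is, up to a shift, the Casimir element; it
  therefore moves freely past powers of \<open>E\<close>.\<close>

lemma F_E_pow_Suc:
  assumes "v \<in> carr M" "K v = v"
  shows "F ((E ^^ Suc n) v) =
    (E ^^ n) (F (E v)) - scl M (qint p n * qint p (Suc n)) ((E ^^ n) v)"
proof (induction n)
  case (Suc n)
  have "F ((E ^^ Suc (Suc n)) v) =
      E (F ((E ^^ Suc n) v)) - scl M (qint p (2 * Suc n)) ((E ^^ Suc n) v)"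
    using E_F[OF assms, of "Suc n"] by simp
  also have "E (F ((E ^^ Suc n) v)) =
      (E ^^ Suc n) (F (E v)) - scl M (qint p n * qint p (Suc n)) ((E ^^ Suc n) v)"
    unfolding Suc.IH using assms by (simp add: act_diff act_scale)
  finally show ?case
    by (simp add: vs.scale_left_distrib qint_Suc_mult_Suc_Suc[OF p_ge_2] algebra_simps
        del: mult_Suc_right)
qed simp

end

text \<open>The automorphism \<open>E \<mapsto> F\<close>, \<open>F \<mapsto> E\<close>, \<open>K \<mapsto> K\<^sup>-\<^sup>1\<close> of the quantum group.\<close>

definition umod_swap :: "'v umod \<Rightarrow> 'v umod" where
  "umod_swap M = M\<lparr>actE := actF M, actF := actE M, actK := actKi M, actKi := actK M\<rparr>"

lemma umod_swap_simps [simp]: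
  "scl (umod_swap M) = scl M" "carr (umod_swap M) = carr M"
  "actE (umod_swap M) = actF M" "actF (umod_swap M) = actE M"
  "actK (umod_swap M) = actKi M" "actKi (umod_swap M) = actK M"
  by (simp_all add: umod_swap_def)

lemma (in umodule) u_module_swap: "u_module p (umod_swap M)"
proof -
  have lin: "umod_linear (umod_swap M) (umod_swap M) f" if "umod_linear M M f" for f
    using that by (simp add: umod_linear_def)
  have "Ki (F (K v)) = scl M (q\<^sup>2) (F v)" if "v \<in> carr M" for v
  proof -
    have "K (F v) = scl M (inverse q ^ 2) (F (K v))"
      using relations(4)[of "K v"] that by (simp add: relations)
    then have "F v = Ki (scl M (inverse q ^ 2) (F (K v)))"
      using relations(2)[of "F v"] that by simp
    also have "\<dots> = scl M (inverse q ^ 2) (Ki (F (K v)))"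
      using that by (simp add: act_scale)
    finally show ?thesis
      by (simp flip: power_mult_distrib)
  qed
  moreover have "Ki (E (K v)) = scl M ((inverse q)\<^sup>2) (E v)" if "v \<in> carr M" for v
  proof -
    have "E v = Ki (scl M (q ^ 2) (E (K v)))"
      using relations(2)[of "E v"] that by (simp add: K_E)
    also have "\<dots> = scl M (q ^ 2) (Ki (E (K v)))"
      using that by (simp add: act_scale)
    finally show ?thesis
      by (simp flip: power_mult_distrib)
  qed
  moreover have "F (E v) - E (F v) = scl M (1 / (q - inverse q)) (Ki v - K v)" if "v \<in> carr M" for v
    using relations(5)[OF that] by (metis minus_diff_eq vs.scale_minus_right)
  \<comment> \<open>The order relation for the inverse of K: cancelling 2p factors against K^(2p) v
    = v.\<close>
  moreover have "(Ki ^^ n) ((K ^^ n) v) = v" if "v \<in> carr M" for v n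
  proof (induction n)
    case (Suc n)
    have "(Ki ^^ Suc n) ((K ^^ Suc n) v) = (Ki ^^ n) (Ki (K ((K ^^ n) v)))"
      by (simp add: funpow_swap1)
    then show ?case
      using Suc that by (simp add: relations)
  qed simp
  then have "(Ki ^^ (2 * p)) v = v" if "v \<in> carr M" for v
    using that relations(8)[of v] by metis
  ultimately show ?thesis
    unfolding u_module_def
    by (auto simp: lin umod_linear_act relations subspace_carr vs.vector_space_axioms)
qed

lemma (in umodule) umodule_swap: "umodule p (umod_swap M)"
  by (simp add: umodule_def p_ge_2 u_module_swap)

subsection \<open>Vectors of weight 1 at the top of the block of the trivial module\<close>

text \<open>On weight 1 the last condition is \<open>C\<^sup>2 v = 0\<close>; written with E and F
  only, it visibly passes through homomorphisms.\<close>

definition top_vector :: "'v::ab_group_add umod \<Rightarrow> 'v \<Rightarrow> bool" where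
  "top_vector M v \<longleftrightarrow> v \<in> carr M \<and> actK M v = v \<and> actF M (actE M (actF M (actE M v))) = 0"

text \<open>Index \<open>Inl i\<close> is the E side and \<open>Inr i\<close> the F side. The slot
  \<open>Inr 0\<close> would repeat v, so it holds F E v instead; each side then has exactly p
  slots.\<close>

definition ladder :: "'v umod \<Rightarrow> 'v \<Rightarrow> nat + nat \<Rightarrow> 'v" where
  "ladder M v = case_sum (\<lambda>i. (actE M ^^ i) v)
     (\<lambda>i. if i = 0 then actF M (actE M v) else (actF M ^^ i) v)"

lemma ladder_simps [simp]:
  "ladder M v (Inl i) = (actE M ^^ i) v"
  "ladder M v (Inr 0) = actF M (actE M v)"
  "ladder M v (Inr (Suc i)) = (actF M ^^ Suc i) v"
  by (simp_all add: ladder_def)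

definition rungs :: "nat \<Rightarrow> (nat + nat) set" where
  "rungs p = {..<p} <+> {..<p}"

lemma finite_rungs [simp]: "finite (rungs p)"
  by (simp add: rungs_def)

lemma in_rungs [simp]: "Inl i \<in> rungs p \<longleftrightarrow> i < p" "Inr i \<in> rungs p \<longleftrightarrow> i < p"
  by (auto simp: rungs_def)

fun flip_rung :: "nat + nat \<Rightarrow> nat + nat" where
  "flip_rung (Inl 0) = Inl 0"
| "flip_rung (Inl (Suc i)) = Inr (Suc i)"
| "flip_rung (Inr 0) = Inr 0"
| "flip_rung (Inr (Suc i)) = Inl (Suc i)"

lemma flip_flip_rung [simp]: "flip_rung (flip_rung k) = k"
  by (cases k rule: flip_rung.cases) simp_all

lemma flip_rung_in_rungs [simp]: "flip_rung k \<in> rungs p \<longleftrightarrow> k \<in> rungs p"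
  by (cases k rule: flip_rung.cases) simp_all

lemma bij_flip_rung: "bij_betw flip_rung (rungs p) (rungs p)"
  by (rule bij_betw_byWitness[where f' = flip_rung]) auto

text \<open>A pair of coefficient and target rung, independent of the module. Where E gives zero the
  target is an arbitrary admissible rung, so that \<open>raise_in_rungs\<close> has no
  exceptions.\<close>

fun raise :: "nat \<Rightarrow> nat + nat \<Rightarrow> complex \<times> (nat + nat)" where
  "raise p (Inl i) = (if Suc i < p then (1, Inl (Suc i)) else (0, Inl 0))"
| "raise p (Inr 0) = (0, Inl 0)"
| "raise p (Inr (Suc 0)) = (1, Inr 0)"
| "raise p (Inr (Suc (Suc i))) = (- (qint p (Suc i) * qint p (Suc (Suc i))), Inr (Suc i))"

definition lower :: "nat \<Rightarrow> nat + nat \<Rightarrow> complex \<times> (nat + nat)" where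
  "lower p k = map_prod id flip_rung (raise p (flip_rung k))"

text \<open>At \<open>Inr 0\<close> the formula yields 1, which is indeed the weight of F E
  v.\<close>

fun weight :: "nat \<Rightarrow> nat + nat \<Rightarrow> complex" where
  "weight p (Inl i) = qroot p ^ (2 * i)"
| "weight p (Inr i) = inverse (qroot p ^ (2 * i))"

lemma raise_in_rungs: "2 \<le> p \<Longrightarrow> k \<in> rungs p \<Longrightarrow> snd (raise p k) \<in> rungs p"
  by (cases "(p, k)" rule: raise.cases) auto

lemma lower_in_rungs: "2 \<le> p \<Longrightarrow> k \<in> rungs p \<Longrightarrow> snd (lower p k) \<in> rungs p"
  using raise_in_rungs[of p "flip_rung k"] by (simp add: lower_def)

context umodule
begin

lemma Ki_fixed: "v \<in> carr M \<Longrightarrow> K v = v \<Longrightarrow> Ki v = v"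
  using relations(2)[of v] by simp

text \<open>E and F commute on weight 1; this is applied to v and to F E v, which again has weight
  1. Every later statement about E thereby has a mirror image about F.\<close>

lemma top_vector_swap:
  assumes "top_vector M v"
  shows "top_vector (umod_swap M) v"
proof -
  have v: "v \<in> carr M" "K v = v"
    using assms by (simp_all add: top_vector_def)
  then show ?thesis
    using assms EF_eq_FE[of v] EF_eq_FE[of "F (E v)"] K_FE[of v]
    by (simp add: top_vector_def Ki_fixed)
qed

lemma ladder_swap:
  assumes "top_vector M v"
  shows "ladder (umod_swap M) v (flip_rung k) = ladder M v k"
  using assms EF_eq_FE[of v]
  by (cases k rule: flip_rung.cases) (simp_all add: top_vector_def)

text \<open>Since \<open>E\<^sup>p v = 0\<close> and \<open>[p] = 0\<close>, the formula for \<open>F E\<^sup>p v\<close> gives \<open>E\<^sup>p\<^sup>-\<^sup>1 F E v = 0\<close>.  On the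
  powers \<open>E\<^sup>j F E v\<close> with \<open>0 < j < p - 1\<close> the operator \<open>F E\<close> is a nonzero scalar, so they vanish
  one after the other.\<close>

lemma top_vector_E:
  assumes "top_vector M v"
  shows "E (F (E v)) = 0"
proof -
  have v: "v \<in> carr M" "K v = v" and 0: "F (E (F (E v))) = 0"
    using assms by (simp_all add: top_vector_def)
  define w where "w = F (E v)"
  have w: "w \<in> carr M" "K w = w" "F (E w) = 0"
    using v 0 K_FE by (simp_all add: w_def)
  have "(E ^^ (p - 1)) w = 0"
    using F_E_pow_Suc[OF v, of "p - 1"] p_ge_2 v relations(6)[OF v(1)]
    by (simp add: w_def qint_p)
  moreover have "(E ^^ j) w = 0" if "1 \<le> j" "j < p - 1" "(E ^^ Suc j) w = 0" for j
    using that F_E_pow_Suc[OF w(1,2), of j] w(3) qint_nonzero[of j p] qint_nonzero[of "Suc j" p]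
    by simp
  ultimately have "(E ^^ 1) w = 0"
    using p_ge_2 by (intro inc_induct[of 1 "p - 1" "\<lambda>j. (E ^^ j) w = 0"]) auto
  then show ?thesis
    by (simp add: w_def)
qed

lemma top_vector_FFE:
  assumes "top_vector M v"
  shows "F (F (E v)) = 0"
proof -
  have "v \<in> carr M" "K v = v"
    using assms by (simp_all add: top_vector_def)
  then show ?thesis
    using umodule.top_vector_E[OF umodule_swap top_vector_swap[OF assms]] by (simp add: EF_eq_FE)
qed

text \<open>In \<open>F_E_pow_Suc\<close> the first term contains E F E v = 0 as soon as n > 0, and
  only the scalar remains.\<close>

lemma F_ladder_E_pow:
  assumes "top_vector M v" "n > 0"
  shows "F ((E ^^ Suc n) v) = scl M (- (qint p n * qint p (Suc n))) ((E ^^ n) v)"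
proof -
  obtain m where m: "n = Suc m"
    using assms(2) gr0_conv_Suc by blast
  have "(E ^^ n) (F (E v)) = 0"
    by (simp only: m funpow_Suc_right o_apply top_vector_E[OF assms(1)] act_pow_0)
  moreover have "F ((E ^^ Suc n) v) = (E ^^ n) (F (E v)) - scl M (qint p n * qint p (Suc n)) ((E ^^ n) v)"
    using assms by (intro F_E_pow_Suc) (simp_all add: top_vector_def)
  ultimately show ?thesis
    by simp
qed

lemma E_ladder_F_pow:
  assumes "top_vector M v" "n > 0"
  shows "E ((F ^^ Suc n) v) = scl M (- (qint p n * qint p (Suc n))) ((F ^^ n) v)"
  using umodule.F_ladder_E_pow[OF umodule_swap top_vector_swap[OF assms(1)] assms(2)] by simp

lemma ladder_carr:
  assumes "top_vector M v"
  shows "ladder M v k \<in> carr M"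
  using assms by (cases k rule: flip_rung.cases) (auto simp: top_vector_def)

lemma E_ladder:
  assumes "top_vector M v" "k \<in> rungs p"
  shows "E (ladder M v k) = scl M (fst (raise p k)) (ladder M v (snd (raise p k)))"
proof (cases "(p, k)" rule: raise.cases)
  case (1 p' i)
  then show ?thesis
    using assms relations(6)[of v] p_ge_2
    by (cases "Suc i < p") (auto simp: top_vector_def dest!: le_antisym[OF Suc_leI])
next
  case (4 p' i)
  then show ?thesis
    using E_ladder_F_pow[OF assms(1), of "Suc i"] by simp
qed (use assms in \<open>auto simp: top_vector_E top_vector_def EF_eq_FE\<close>)

lemma F_ladder:
  assumes "top_vector M v" "k \<in> rungs p"
  shows "F (ladder M v k) = scl M (fst (lower p k)) (ladder M v (snd (lower p k)))"
  using umodule.E_ladder[OF umodule_swap top_vector_swap[OF assms(1)], of "flip_rung k"] assms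
    ladder_swap[OF assms(1), of "flip_rung (snd (raise p (flip_rung k)))"]
  by (simp add: ladder_swap lower_def)

lemma K_ladder:
  assumes "top_vector M v"
  shows "K (ladder M v k) = scl M (weight p k) (ladder M v k)"
proof -
  have v: "v \<in> carr M" "K v = v"
    using assms by (simp_all add: top_vector_def)
  interpret swap: umodule p "umod_swap M"
    by (rule umodule_swap)
  show ?thesis
    using K_E_pow[OF v] swap.Ki_E_pow[of v] v
    by (cases k rule: flip_rung.cases) (simp_all add: Ki_fixed K_FE del: funpow.simps)
qed

lemma Ki_ladder:
  assumes "top_vector M v"
  shows "Ki (ladder M v k) = scl M (inverse (weight p k)) (ladder M v k)"
  using assms by (intro Ki_eigen K_ladder ladder_carr) (cases k; simp)+

section \<open>Linear independence of the ladder\<close>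

lemma E_pow_ladder_Inr:
  assumes "top_vector M v" "n < p"
  obtains d where "d \<noteq> 0" "(E ^^ n) (ladder M v (Inr n)) = scl M d (F (E v))"
proof -
  have "\<exists>d. d \<noteq> 0 \<and> (E ^^ n) (ladder M v (Inr n)) = scl M d (F (E v))"
    using assms(2)
  proof (induction n)
    case 0
    show ?case
      by (rule exI[of _ 1]) simp
  next
    case (Suc n)
    then obtain d where d: "d \<noteq> 0" "(E ^^ n) (ladder M v (Inr n)) = scl M d (F (E v))"
      by auto
    \<comment> \<open>From F v to F E v the constant is 1; further down it is -[n][n+1], nonzero
      because n + 1 < p.\<close>
    define e where "e = fst (raise p (Inr (Suc n)))"
    have e: "e \<noteq> 0" "raise p (Inr (Suc n)) = (e, Inr n)"
      using qint_nonzero[of n p] qint_nonzero[of "Suc n" p] Suc.prems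
      by (cases n; simp add: e_def)+
    have "(E ^^ Suc n) (ladder M v (Inr (Suc n))) = (E ^^ n) (E (ladder M v (Inr (Suc n))))"
      by (simp add: funpow_swap1)
    also have "\<dots> = scl M (e * d) (F (E v))"
      using E_ladder[OF assms(1), of "Inr (Suc n)"] e d Suc.prems
        umod_linear_scale[OF umod_linear_act_pow(1) ladder_carr[OF assms(1)]]
      by (simp del: funpow.simps ladder_simps)
    finally show ?case
      using d e by (intro exI[of _ "e * d"]) simp
  qed
  then show ?thesis
    using that by blast
qed

lemma E_pow_ladder_Inr_eq_0:
  assumes "top_vector M v" "i < n" "n < p"
  shows "(E ^^ n) (ladder M v (Inr i)) = 0"
proof -
  obtain d where d: "(E ^^ i) (ladder M v (Inr i)) = scl M d (F (E v))"
    using E_pow_ladder_Inr[OF assms(1), of i] assms by auto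
  have "(E ^^ n) (ladder M v (Inr i)) = (E ^^ (n - i - 1)) (E ((E ^^ i) (ladder M v (Inr i))))"
    using assms funpow_add[of "n - i - 1" "Suc i" E] by simp
  also have "\<dots> = 0"
    using assms by (simp add: d act_scale top_vector_E top_vector_def)
  finally show ?thesis .
qed

definition ladder_comb :: "'v \<Rightarrow> (nat + nat \<Rightarrow> complex) \<Rightarrow> 'v" where
  "ladder_comb v c = (\<Sum>k\<in>rungs p. scl M (c k) (ladder M v k))"

lemma ladder_comb_carr: "top_vector M v \<Longrightarrow> ladder_comb v c \<in> carr M"
  by (simp add: ladder_comb_def carr_sum ladder_carr)

text \<open>The power p - 1 - k of E kills E^i v for i > k and F^i v for i < p - 1 - k, while the
  hypotheses remove the coefficients on the other side of these bounds. One rung of each side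
  survives, so the power reads off two coefficients at once.\<close>

lemma E_pow_ladder_comb:
  assumes v: "top_vector M v" and k: "k < p"
    and l: "\<And>i. i < k \<Longrightarrow> c (Inl i) = 0" and r: "\<And>i. p - k \<le> i \<Longrightarrow> i < p \<Longrightarrow> c (Inr i) = 0"
  obtains d where "d \<noteq> 0"
    "(E ^^ (p - 1 - k)) (ladder_comb v c) =
       scl M (c (Inl k)) ((E ^^ (p - 1)) v) + scl M (c (Inr (p - 1 - k)) * d) (F (E v))"
proof -
  let ?n = "p - 1 - k"
  have vc: "v \<in> carr M"
    using v by (simp add: top_vector_def)
  obtain d where d: "d \<noteq> 0" "(E ^^ ?n) (ladder M v (Inr ?n)) = scl M d (F (E v))"
    using E_pow_ladder_Inr[OF v, of ?n] k by auto
  have "(E ^^ ?n) (ladder_comb v c) = (\<Sum>k\<in>rungs p. scl M (c k) ((E ^^ ?n) (ladder M v k)))"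
    unfolding ladder_comb_def
    by (simp add: umod_linear_sum[OF umod_linear_act_pow(1)]
        umod_linear_scale[OF umod_linear_act_pow(1)] ladder_carr[OF v])
  also have "\<dots> = (\<Sum>i<p. scl M (c (Inl i)) ((E ^^ ?n) (ladder M v (Inl i)))) +
      (\<Sum>i<p. scl M (c (Inr i)) ((E ^^ ?n) (ladder M v (Inr i))))"
    unfolding rungs_def by (subst sum.Plus) (simp_all add: o_def)
  also have "(\<Sum>i<p. scl M (c (Inl i)) ((E ^^ ?n) (ladder M v (Inl i)))) =
      (\<Sum>i\<in>{k}. scl M (c (Inl i)) ((E ^^ ?n) (ladder M v (Inl i))))"
  proof (rule sum.mono_neutral_right)
    show "\<forall>i\<in>{..<p} - {k}. scl M (c (Inl i)) ((E ^^ ?n) (ladder M v (Inl i))) = 0"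
    proof
      fix i assume "i \<in> {..<p} - {k}"
      then consider "i < k" | "i > k" "i < p"
        by force
      then show "scl M (c (Inl i)) ((E ^^ ?n) (ladder M v (Inl i))) = 0"
      proof cases
        case 2
        then have "(E ^^ (?n + i)) v = 0"
          using k by (intro E_pow_ge_p vc) simp
        then show ?thesis
          by (simp only: funpow_add o_apply ladder_simps vs.scale_zero_right)
      qed (simp add: l)
    qed
  qed (use k in auto)
  also have "\<dots> = scl M (c (Inl k)) ((E ^^ (p - 1)) v)"
    using k funpow_add[of "?n" k E] by (simp add: fun_eq_iff)
  also have "(\<Sum>i<p. scl M (c (Inr i)) ((E ^^ ?n) (ladder M v (Inr i)))) =
      (\<Sum>i\<in>{?n}. scl M (c (Inr i)) ((E ^^ ?n) (ladder M v (Inr i))))"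
  proof (rule sum.mono_neutral_right)
    show "\<forall>i\<in>{..<p} - {?n}. scl M (c (Inr i)) ((E ^^ ?n) (ladder M v (Inr i))) = 0"
    proof
      fix i assume "i \<in> {..<p} - {?n}"
      then consider "i < ?n" | "p - k \<le> i" "i < p"
        by force
      then show "scl M (c (Inr i)) ((E ^^ ?n) (ladder M v (Inr i))) = 0"
        by cases (use k in \<open>simp_all add: r E_pow_ladder_Inr_eq_0[OF v]\<close>)
    qed
  qed (use k in auto)
  also have "\<dots> = scl M (c (Inr ?n) * d) (F (E v))"
    using d by simp
  finally show ?thesis
    using that d by blast
qed

text \<open>Mirror image of \<open>E_pow_ladder_Inr\<close>. Here n > 0, because the slot
  \<open>Inr 0\<close> holds F E v and not v.\<close>

lemma F_pow_E_pow:
  assumes "top_vector M v" "0 < n" "n < p"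
  obtains d where "d \<noteq> 0" "(F ^^ n) ((E ^^ n) v) = scl M d (F (E v))"
proof -
  have "v \<in> carr M" "K v = v"
    using assms(1) by (simp_all add: top_vector_def)
  moreover obtain m where "n = Suc m"
    using assms(2) gr0_conv_Suc by blast
  ultimately show ?thesis
    using umodule.E_pow_ladder_Inr[OF umodule_swap top_vector_swap[OF assms(1)] assms(3)] that
    by (auto simp: EF_eq_FE simp del: funpow.simps)
qed

lemma F_pow_FE:
  assumes "top_vector M v" "0 < n"
  shows "(F ^^ n) (F (E v)) = 0"
proof -
  obtain m where "n = Suc m"
    using assms(2) gr0_conv_Suc by blast
  then show ?thesis
    using assms by (simp add: funpow_swap1 top_vector_FFE)
qed

text \<open>Coefficients are peeled off in pairs: E^k v from the bottom of the E side together with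
  F^(p-1-k) v from the far end of the F side.\<close>

lemma ladder_independent:
  assumes v: "top_vector M v" and nz: "F (E v) \<noteq> 0" and 0: "ladder_comb v c = 0"
    and k: "k \<in> rungs p"
  shows "c k = 0"
proof -
  have vc: "v \<in> carr M"
    using v by (simp add: top_vector_def)
  have "(\<forall>i<k. c (Inl i) = 0) \<and> (\<forall>i. p - k \<le> i \<and> i < p \<longrightarrow> c (Inr i) = 0)" if "k \<le> p" for k
    using that
  proof (induction k)
    case (Suc k)
    obtain d where d: "d \<noteq> 0" "(E ^^ (p - 1 - k)) (ladder_comb v c) =
        scl M (c (Inl k)) ((E ^^ (p - 1)) v) + scl M (c (Inr (p - 1 - k)) * d) (F (E v))"
      using E_pow_ladder_comb[OF v, of k c] Suc by auto
    then have eq: "scl M (c (Inl k)) ((E ^^ (p - 1)) v) + scl M (c (Inr (p - 1 - k)) * d) (F (E v)) = 0"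
      by (simp add: 0)
    obtain e where e: "e \<noteq> 0" "(F ^^ (p - 1)) ((E ^^ (p - 1)) v) = scl M e (F (E v))"
      using F_pow_E_pow[OF v, of "p - 1"] p_ge_2 by auto
    \<comment> \<open>F^(p-1) separates the two surviving terms: it kills F E v and sends E^(p-1) v
      to a nonzero multiple of F E v.\<close>
    have "(F ^^ (p - 1)) (scl M (c (Inl k)) ((E ^^ (p - 1)) v) +
        scl M (c (Inr (p - 1 - k)) * d) (F (E v))) = scl M (c (Inl k) * e) (F (E v))"
      using vc p_ge_2 by (simp add: umod_linear_add[OF umod_linear_act_pow(2)]
          umod_linear_scale[OF umod_linear_act_pow(2)] e[unfolded One_nat_def] F_pow_FE[OF v])
    then have "c (Inl k) = 0"
      using eq nz e by simp
    moreover from this have "c (Inr (p - 1 - k)) = 0"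
      using eq nz d by simp
    ultimately have "c (Inl i) = 0" if "i = k \<or> i < k" for i
      using that Suc by auto
    moreover have "c (Inr i) = 0" if "i = p - 1 - k \<or> p - k \<le> i \<and> i < p" for i
      using that \<open>c (Inr (p - 1 - k)) = 0\<close> Suc by auto
    moreover have "i = p - 1 - k \<or> p - k \<le> i" if "p - Suc k \<le> i" for i
      using that by auto
    ultimately show ?case
      by (metis less_Suc_eq)
  qed auto
  from this[of p] show ?thesis
    using k by (cases k) auto
qed

end

subsection \<open>Homomorphisms and lifting\<close>

lemma umod_hom_linear: "umod_hom M N f \<Longrightarrow> umod_linear M N f"
  by (simp add: umod_hom_def)

lemma umod_hom_act:
  assumes "umod_hom M N f" "v \<in> carr M"
  shows "f (actE M v) = actE N (f v)" "f (actF M v) = actF N (f v)"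
    "f (actK M v) = actK N (f v)" "f (actKi M v) = actKi N (f v)"
  using assms by (simp_all add: umod_hom_def)

context umodule
begin

lemma umod_hom_pow:
  assumes "umod_hom M N f" "v \<in> carr M"
  shows "f ((E ^^ n) v) = (actE N ^^ n) (f v)" "f ((F ^^ n) v) = (actF N ^^ n) (f v)"
    "f ((K ^^ n) v) = (actK N ^^ n) (f v)"
  using assms by (induction n) (simp_all add: umod_hom_act)

lemma umod_hom_ladder:
  assumes "umod_hom M N f" "v \<in> carr M"
  shows "f (ladder M v k) = ladder N (f v) k"
  using assms umod_hom_pow[OF assms] by (cases k rule: flip_rung.cases) (simp_all add: umod_hom_act)

lemma top_vector_hom:
  assumes "umod_hom M N f" "top_vector M v"
  shows "top_vector N (f v)"
proof -
  have v: "v \<in> carr M" "K v = v" "F (E (F (E v))) = 0"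
    using assms(2) by (simp_all add: top_vector_def)
  have "actF N (actE N (actF N (actE N (f v)))) = f (F (E (F (E v))))"
    using v(1) by (simp add: umod_hom_act[OF assms(1)])
  also have "\<dots> = 0"
    using umod_linear_0[OF umod_hom_linear[OF assms(1)]] v(3) by simp
  finally show ?thesis
    using v umod_hom_act(3)[OF assms(1) v(1)] umod_linear_carr[OF umod_hom_linear[OF assms(1)] v(1)]
    by (simp add: top_vector_def)
qed

text \<open>\<open>FE\<close> acts on the vectors of weight 1, and there \<open>F\<^sup>n E\<^sup>n = \<Prod>\<^sub>i\<^sub><\<^sub>n (FE - [i][i+1])\<close>.\<close>

lemma F_pow_E_pow_Suc:
  assumes "v \<in> carr M" "K v = v"
  shows "(F ^^ Suc n) ((E ^^ Suc n) v) =
    (F ^^ n) ((E ^^ n) (F (E v))) - scl M (qint p n * qint p (Suc n)) ((F ^^ n) ((E ^^ n) v))"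
proof -
  have "(F ^^ Suc n) ((E ^^ Suc n) v) = (F ^^ n) (F ((E ^^ Suc n) v))"
    by (simp add: funpow_swap1)
  also have "\<dots> = (F ^^ n) ((E ^^ n) (F (E v)) - scl M (qint p n * qint p (Suc n)) ((E ^^ n) v))"
    by (simp only: F_E_pow_Suc[OF assms])
  finally show ?thesis
    using assms by (simp add: umod_linear_diff[OF umod_linear_act_pow(2)]
        umod_linear_scale[OF umod_linear_act_pow(2)])
qed

text \<open>By \<open>F_pow_E_pow_Suc\<close>, F^n E^n is on weight 1 a polynomial in F E. The
  vector stays arbitrary in the induction since the recursion passes from v to F E v.\<close>

lemma FE_F_pow_E_pow:
  assumes "v \<in> carr M" "K v = v"
  shows "F (E ((F ^^ n) ((E ^^ n) v))) = (F ^^ n) ((E ^^ n) (F (E v)))"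
  using assms
proof (induction n arbitrary: v)
  case (Suc n)
  then show ?case
    unfolding F_pow_E_pow_Suc[OF Suc.prems] F_pow_E_pow_Suc[OF act_carr(2)[OF act_carr(1)[OF Suc.prems(1)]] K_FE[OF Suc.prems]]
    by (simp add: act_diff act_scale K_FE)
qed simp

text \<open>Passing from \<open>u\<close> to \<open>u - c\<^sup>-\<^sup>2 (FE)\<^sup>2 u\<close> with \<open>c = [n][n+1]\<close> removes the factor \<open>FE - c\<close> from
  an annihilating product of \<open>u\<close>, because \<open>1 - X\<^sup>2/c\<^sup>2\<close> is divisible by \<open>X - c\<close>; it does not change
  \<open>g u\<close>, because \<open>(FE)\<^sup>2\<close> kills that vector.\<close>

lemma lift_top_vector_aux:
  assumes N: "umodule p N" and g: "umod_hom M N g" and t: "top_vector N t"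
    and n: "Suc n < p" and u: "u \<in> carr M" "K u = u" "g u = t"
    and 0: "(F ^^ Suc n) ((E ^^ Suc n) (F (E u))) = 0"
  shows "\<exists>v. top_vector M v \<and> g v = t"
  using n u 0
proof (induction n arbitrary: u)
  case 0
  then show ?case
    by (auto simp: top_vector_def)
next
  case (Suc n)
  interpret N: umodule p N
    by (rule N)
  define c where "c = qint p (Suc n) * qint p (Suc (Suc n))"
  define T where "T = (\<lambda>v. F (E v))"
  define A where "A = (\<lambda>v. (F ^^ Suc n) ((E ^^ Suc n) v))"
  have "c \<noteq> 0"
    using Suc.prems(1) qint_nonzero[of "Suc n" p] qint_nonzero[of "Suc (Suc n)" p]
    by (simp add: c_def)
  have T_carr: "T v \<in> carr M" if "v \<in> carr M" for v
    using that by (simp add: T_def)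
  have K_T: "K (T v) = T v" if "v \<in> carr M" "K v = v" for v
    using that by (simp add: T_def K_FE)
  have A_T: "A (T v) = T (A v)" if "v \<in> carr M" "K v = v" for v
    unfolding A_def T_def using FE_F_pow_E_pow[OF that, of "Suc n"] by simp
  have A_scale: "A (scl M r v) = scl M r (A v)" and A_diff: "A (v - w) = A v - A w"
    and A_carr: "A v \<in> carr M" if "v \<in> carr M" "w \<in> carr M" for r v w
    unfolding A_def using that
    by (simp_all only: umod_linear_act_pow[THEN umod_linear_scale]
        umod_linear_act_pow[THEN umod_linear_diff] act_pow_carr)
  have T_scale: "T (scl M r v) = scl M r (T v)" and T_diff: "T (v - w) = T v - T w"
    if "v \<in> carr M" "w \<in> carr M" for r v w
    using that by (simp_all add: T_def act_scale act_diff)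
  define u' where "u' = u - scl M (1 / c ^ 2) (T (T u))"
  note u = Suc.prems(2-4)
  have "(F ^^ Suc (Suc n)) ((E ^^ Suc (Suc n)) (T u)) = 0"
    using Suc.prems(5) by (simp only: T_def)
  then have *: "A (T (T u)) = scl M c (A (T u))"
    using F_pow_E_pow_Suc[OF T_carr[OF u(1)] K_T[OF u(1,2)], of "Suc n"]
    by (simp only: c_def A_def T_def) simp
  \<comment> \<open>On \<open>A (T u)\<close> the operator \<open>T\<close> acts as the scalar c,
    hence its square as c^2; this cancels against the factor 1 / c^2 in \<open>u'\<close>.\<close>
  have "A (T (T (T u))) = scl M (c ^ 2) (A (T u))"
    using * A_T[of "T (T u)"] A_T[of "T u"] u
    by (simp add: T_carr K_T T_scale A_carr power2_eq_square)
  then have "A (T u') = 0"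
    unfolding u'_def using u \<open>c \<noteq> 0\<close> by (simp add: T_diff T_scale A_diff A_scale T_carr)
  moreover have "u' \<in> carr M" "K u' = u'"
    using u by (simp_all add: u'_def T_carr K_T act_diff act_scale)
  moreover have "g u' = t"
  proof -
    have "g (T (T u)) = 0"
      using t u g by (simp add: T_def umod_hom_act top_vector_def)
    then show ?thesis
      using u umod_hom_linear[OF g] unfolding u'_def
      by (simp add: umod_linear_diff umod_linear_scale T_carr)
  qed
  ultimately show ?case
    using Suc.IH[of u'] Suc.prems(1) by (simp add: A_def T_def)
qed

text \<open>An arbitrary preimage is first projected to weight 1 and then corrected by
  \<open>lift_top_vector_aux\<close>.\<close>

lemma lift_top_vector:
  assumes N: "umodule p N" and g: "umod_hom M N g" "g ` carr M = carr N" and t: "top_vector N t"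
  shows "\<exists>v. top_vector M v \<and> g v = t"
proof -
  interpret N: umodule p N
    by (rule N)
  note lin = umod_hom_linear[OF g(1)]
  have tc: "t \<in> carr N" "N.K t = t"
    using t by (simp_all add: top_vector_def)
  obtain u where u: "u \<in> carr M" "g u = t"
    using g(2) tc(1) by (metis imageE)
  \<comment> \<open>Averaging over the powers of K, with K^(2p) = 1, is the projection onto weight
    1. It does not change the image, because t already has weight 1.\<close>
  define s where "s = (\<Sum>j<2 * p. (K ^^ j) u)"
  define w where "w = scl M (1 / (2 * p)) s"
  have s: "s \<in> carr M"
    using u by (simp add: s_def carr_sum)
  have "K s = (\<Sum>j<2 * p. (K ^^ Suc j) u)"
    using u by (simp add: s_def act_sum)
  also have "\<dots> = s"
  proof -
    have "s + u = u + (\<Sum>j<2 * p. (K ^^ Suc j) u)"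
      using sum.lessThan_Suc_shift[of "\<lambda>j. (K ^^ j) u" "2 * p"] relations(8)[OF u(1)]
      by (simp add: s_def)
    then show ?thesis
      by (simp add: add.commute[of s])
  qed
  finally have K: "K w = w"
    using s by (simp add: w_def act_scale)
  have "(N.K ^^ j) t = t" for j
    by (induction j) (simp_all add: tc)
  then have "g s = (\<Sum>j<2 * p. t)"
    using u umod_hom_pow(3)[OF g(1)] by (simp add: s_def umod_linear_sum[OF lin])
  also have "\<dots> = scl N (2 * p) t"
    by (subst N.vs.sum_constant_scale) simp
  finally have "g w = t"
    using s p_ge_2 by (simp add: w_def umod_linear_scale[OF lin])
  moreover have w: "w \<in> carr M"
    using s by (simp add: w_def)
  \<comment> \<open>In \<open>F_pow_E_pow_Suc\<close> with n = p - 1 the left side contains E^p w =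
    0 and the scalar contains [p] = 0. What is left has the form required by
    \<open>lift_top_vector_aux\<close> at p - 2.\<close>
  moreover have "(F ^^ (p - 1)) ((E ^^ (p - 1)) (F (E w))) = 0"
    using F_pow_E_pow_Suc[OF w K, of "p - 1"] p_ge_2 relations(6)[OF w] w
    by (simp add: qint_p del: funpow.simps)
  ultimately show ?thesis
    using lift_top_vector_aux[OF N g(1) t, of "p - 2" w] p_ge_2 K
    by (simp add: numeral_2_eq_2 Suc_diff_Suc del: funpow.simps)
qed

end

subsection \<open>The projective cover of the trivial module\<close>

text \<open>An internal description of the module P^+_1: by \<open>ladder_independent\<close> the 2p
  rungs are a basis, with structure constants that depend on p alone.\<close>

locale ladder_module = umodule p M for p and M :: "'v::ab_group_add umod" +
  fixes t :: 'v
  assumes top: "top_vector M t" and FE_nonzero: "F (E t) \<noteq> 0"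
    and carr_eq: "carr M = vs.span (ladder M t ` rungs p)"
begin

lemma t_carr: "t \<in> carr M"
  using top by (simp add: top_vector_def)

lemma ladder_comb_exists:
  assumes "v \<in> carr M"
  obtains c where "v = ladder_comb t c"
proof -
  have "v \<in> vs.span (ladder M t ` rungs p)"
    using assms carr_eq by simp
  then have "\<exists>c. v = ladder_comb t c"
  proof (induction rule: vs.span_induct_alt)
    case base
    have "ladder_comb t (\<lambda>_. 0) = 0"
      by (simp add: ladder_comb_def)
    then show ?case
      by metis
  next
    case (step a x y)
    then obtain k c where kc: "k \<in> rungs p" "x = ladder M t k" "y = ladder_comb t c"
      by auto
    have "ladder_comb t (\<lambda>j. (if j = k then a else 0) + c j) =
        (\<Sum>j\<in>rungs p. if j = k then scl M a (ladder M t k) else 0) + ladder_comb t c"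
      unfolding ladder_comb_def vs.scale_left_distrib sum.distrib
      by (intro arg_cong2[where f = "(+)"] sum.cong) auto
    then show ?case
      using kc by (auto intro!: exI[of _ "\<lambda>j. (if j = k then a else 0) + c j"])
  qed
  then show ?thesis
    using that by blast
qed

lemma ladder_comb_unique:
  assumes "ladder_comb t c = ladder_comb t d" "k \<in> rungs p"
  shows "c k = d k"
proof -
  have "ladder_comb t (\<lambda>j. c j - d j) = 0"
    using assms by (simp add: ladder_comb_def vs.scale_left_diff_distrib sum_subtractf)
  then show ?thesis
    using ladder_independent[OF top FE_nonzero, of "\<lambda>j. c j - d j" k] assms(2) by simp
qed

text \<open>The module is universal for top vectors: the rungs of v satisfy the same relations as
  the basis, even when F E v = 0, as happens for the quotient map onto the trivial module.\<close>

lemma hom_exists: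
  assumes N: "umodule p N" and v: "top_vector N v"
  obtains h where "umod_hom M N h" "\<And>c. h (ladder_comb t c) = umodule.ladder_comb p N v c"
proof -
  interpret N: umodule p N
    by (rule N)
  \<comment> \<open>The coefficients are unique on the rungs only; elsewhere the choice is
    arbitrary, but \<open>ladder_comb\<close> does not see those values.\<close>
  define h where "h x = N.ladder_comb v (SOME c. x = ladder_comb t c)" for x
  have h: "h (ladder_comb t c) = N.ladder_comb v c" for c
  proof -
    define d where "d = (SOME d. ladder_comb t c = ladder_comb t d)"
    have "ladder_comb t c = ladder_comb t d"
      unfolding d_def by (rule someI[of _ c]) simp
    then have "N.ladder_comb v d = N.ladder_comb v c"
      using ladder_comb_unique[of c d] by (simp add: N.ladder_comb_def cong: sum.cong)
    then show ?thesis
      by (simp add: h_def d_def)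
  qed
  have lin: "umod_linear M N h"
    unfolding umod_linear_def
  proof (intro conjI ballI allI)
    fix x assume "x \<in> carr M"
    then obtain c where x: "x = ladder_comb t c"
      by (rule ladder_comb_exists)
    show "h x \<in> carr N"
      by (simp add: x h N.ladder_comb_carr[OF v])
    have "scl M r x = ladder_comb t (\<lambda>k. r * c k)" for r
      by (simp add: x ladder_comb_def vs.scale_sum_right)
    then show "h (scl M r x) = scl N r (h x)" for r
      by (simp add: h) (simp add: x h N.ladder_comb_def N.vs.scale_sum_right)
    fix y assume "y \<in> carr M"
    then obtain d where y: "y = ladder_comb t d"
      by (rule ladder_comb_exists)
    have "x + y = ladder_comb t (\<lambda>k. c k + d k)"
      by (simp add: x y ladder_comb_def vs.scale_left_distrib sum.distrib)
    then show "h (x + y) = h x + h y"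
      by (simp add: h) (simp add: x y h N.ladder_comb_def N.vs.scale_left_distrib sum.distrib)
  qed
  have h_ladder: "h (ladder M t k) = ladder N v k" if "k \<in> rungs p" for k
  proof -
    have "ladder_comb t (\<lambda>j. if j = k then 1 else 0) = (\<Sum>j\<in>rungs p. if j = k then ladder M t k else 0)"
      and "N.ladder_comb v (\<lambda>j. if j = k then 1 else 0) = (\<Sum>j\<in>rungs p. if j = k then ladder N v k else 0)"
      unfolding ladder_comb_def N.ladder_comb_def by (rule sum.cong; simp)+
    then show ?thesis
      using that h[of "\<lambda>j. if j = k then 1 else 0"] by simp
  qed
  have commute: "h (X x) = Y (h x)"
    if x: "x \<in> carr M" and X: "umod_linear M M X" and Y: "umod_linear N N Y"
      and l: "\<And>k. k \<in> rungs p \<Longrightarrow> h (X (ladder M t k)) = Y (ladder N v k)" for X Y x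
  proof -
    obtain c where x: "x = ladder_comb t c"
      using x by (rule ladder_comb_exists)
    have "h (X x) = (\<Sum>k\<in>rungs p. scl N (c k) (h (X (ladder M t k))))"
      unfolding x ladder_comb_def
      by (simp add: umod_linear_sum[OF umod_linear_compose[OF X lin]]
          umod_linear_scale[OF umod_linear_compose[OF X lin]] ladder_carr[OF top])
    also have "\<dots> = Y (N.ladder_comb v c)"
      unfolding N.ladder_comb_def
      by (simp add: l N.umod_linear_sum[OF Y] umod_linear_scale[OF Y] N.ladder_carr[OF v])
    finally show ?thesis
      by (simp add: x h)
  qed
  have "umod_hom M N h"
    unfolding umod_hom_def
  proof (intro conjI ballI lin)
    fix x assume x: "x \<in> carr M"
    show "h (E x) = N.E (h x)"
      by (rule commute[OF x umod_linear_act(1) N.umod_linear_act(1)])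
        (simp add: E_ladder[OF top] N.E_ladder[OF v] umod_linear_scale[OF lin] ladder_carr[OF top]
          h_ladder raise_in_rungs p_ge_2)
    show "h (F x) = N.F (h x)"
      by (rule commute[OF x umod_linear_act(2) N.umod_linear_act(2)])
        (simp add: F_ladder[OF top] N.F_ladder[OF v] umod_linear_scale[OF lin] ladder_carr[OF top]
          h_ladder lower_in_rungs p_ge_2)
    show "h (K x) = N.K (h x)"
      by (rule commute[OF x umod_linear_act(3) N.umod_linear_act(3)])
        (simp add: K_ladder[OF top] N.K_ladder[OF v] umod_linear_scale[OF lin] ladder_carr[OF top]
          h_ladder)
    show "h (Ki x) = N.Ki (h x)"
      by (rule commute[OF x umod_linear_act(4) N.umod_linear_act(4)])
        (simp add: Ki_ladder[OF top] N.Ki_ladder[OF v] umod_linear_scale[OF lin] ladder_carr[OF top]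
          h_ladder)
  qed
  then show ?thesis
    using that h by blast
qed

text \<open>The image f t is a top vector, so it lifts along g to a top vector v, and
  \<open>hom_exists\<close> extends t \<mapsto> v. The triangle commutes because homomorphisms carry
  ladders to ladders.\<close>

lemma projective: "projective_umod TYPE('m::ab_group_add) TYPE('n::ab_group_add) p M"
  unfolding projective_umod_def
proof (intro conjI allI impI u_module)
  fix L :: "'m umod" and N :: "'n umod" and g f
  assume *: "u_module p L \<and> u_module p N \<and> umod_hom L N g \<and> g ` carr L = carr N \<and> umod_hom M N f"
  interpret L: umodule p L
    using * p_ge_2 by (simp add: umodule_def)
  interpret N: umodule p N
    using * p_ge_2 by (simp add: umodule_def)
  have g: "umod_hom L N g" and f: "umod_hom M N f"
    using * by simp_all
  obtain v where v: "top_vector L v" "g v = f t"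
    using L.lift_top_vector[OF N.umodule_axioms g _ top_vector_hom[OF f top]] * by auto
  obtain h where h: "umod_hom M L h" "\<And>c. h (ladder_comb t c) = L.ladder_comb v c"
    using hom_exists[OF L.umodule_axioms v(1)] by blast
  have vc: "v \<in> carr L"
    using v by (simp add: top_vector_def)
  have "g (h x) = f x" if x: "x \<in> carr M" for x
  proof -
    obtain c where c: "x = ladder_comb t c"
      using x by (rule ladder_comb_exists)
    have "g (h x) = (\<Sum>k\<in>rungs p. scl N (c k) (ladder N (g v) k))"
      unfolding c h(2) L.ladder_comb_def
      by (simp add: L.umod_linear_sum[OF umod_hom_linear[OF g]] umod_linear_scale[OF umod_hom_linear[OF g]]
          L.ladder_carr[OF v(1)] L.umod_hom_ladder[OF g vc])
    also have "\<dots> = f x"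
      unfolding c ladder_comb_def v(2)
      by (simp add: umod_linear_sum[OF umod_hom_linear[OF f]] umod_linear_scale[OF umod_hom_linear[OF f]]
          ladder_carr[OF top] umod_hom_ladder[OF f t_carr])
    finally show ?thesis .
  qed
  then show "\<exists>h. umod_hom M L h \<and> (\<forall>v\<in>carr M. g (h v) = f v)"
    using h by blast
qed

end

lemma u_module_trivial:
  assumes "p > 0"
  shows "u_module p trivial_umod"
proof -
  have 1: "vector_space ((*) :: complex \<Rightarrow> _)"
    by unfold_locales (simp_all add: algebra_simps)
  then interpret vector_space "(*) :: complex \<Rightarrow> complex \<Rightarrow> complex" .
  have "((\<lambda>z::complex. 0::complex) ^^ n) v = 0" if "n > 0" for n v
    using that by (cases n) simp_all
  moreover have "((\<lambda>z::complex. z) ^^ n) v = v" for n v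
    by (induction n) simp_all
  ultimately show ?thesis
    using assms by (simp add: u_module_def trivial_umod_def umod_linear_def subspace_UNIV 1)
qed

lemma u_submodule_swap: "u_submodule M W \<Longrightarrow> u_submodule (umod_swap M) W"
  by (simp add: u_submodule_def)

context umodule
begin

lemma ladder_comb_swap:
  assumes "top_vector M v"
  shows "umodule.ladder_comb p (umod_swap M) v (c \<circ> flip_rung) = ladder_comb v c"
proof -
  have "ladder_comb v c = (\<Sum>k\<in>rungs p. scl M (c (flip_rung k)) (ladder M v (flip_rung k)))"
    unfolding ladder_comb_def
    by (rule sum.reindex_bij_betw[OF bij_flip_rung, symmetric])
  also have "\<dots> = umodule.ladder_comb p (umod_swap M) v (c \<circ> flip_rung)"
    using ladder_swap[OF assms, of "flip_rung _"] by (simp add: umodule.ladder_comb_def[OF umodule_swap])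
  finally show ?thesis ..
qed

text \<open>E^(p-1) turns the given vector into E^(p-1) v plus a multiple of F E v, and F^(p-1)
  isolates F E v. Subtraction leaves E^(p-1) v, from which powers of F descend with nonzero
  constants.\<close>

lemma submodule_contains_E_pow:
  assumes v: "top_vector M v" and W: "u_submodule M W"
    and w: "ladder_comb v c \<in> W" "c (Inl 0) = 1"
  shows "F (E v) \<in> W \<and> (\<forall>i. 0 < i \<and> i < p \<longrightarrow> (E ^^ i) v \<in> W)"
proof -
  have subspace: "vs.subspace W" and "\<And>x. x \<in> W \<Longrightarrow> E x \<in> W \<and> F x \<in> W"
    using W by (auto simp: u_submodule_def)
  then have pow: "(E ^^ n) x \<in> W" "(F ^^ n) x \<in> W" if "x \<in> W" for n x
    using that by (induction n) auto
  have cancel: "x \<in> W" if "scl M r x \<in> W" "r \<noteq> 0" for r x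
    using vs.subspace_scale[OF subspace that(1), of "1 / r"] that(2) by simp
  have vc: "v \<in> carr M"
    using v by (simp add: top_vector_def)
  \<comment> \<open>At k = 0 both vanishing conditions of \<open>E_pow_ladder_comb\<close> are
    empty.\<close>
  obtain d where d: "(E ^^ (p - 1)) (ladder_comb v c) =
      (E ^^ (p - 1)) v + scl M (c (Inr (p - 1)) * d) (F (E v))"
    using E_pow_ladder_comb[OF v, of 0 c] p_ge_2 w(2) by (auto simp del: One_nat_def)
  obtain e where e: "e \<noteq> 0" "(F ^^ (p - 1)) ((E ^^ (p - 1)) v) = scl M e (F (E v))"
    using F_pow_E_pow[OF v, of "p - 1"] p_ge_2 by auto
  have "(F ^^ (p - 1)) ((E ^^ (p - 1)) (ladder_comb v c)) = scl M e (F (E v))"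
    unfolding d using vc p_ge_2
    by (simp add: umod_linear_add[OF umod_linear_act_pow(2)] F_pow_FE[OF v]
        umod_linear_scale[OF umod_linear_act_pow(2)] e[unfolded One_nat_def])
  then have FE: "F (E v) \<in> W"
    using pow w(1) cancel e(1) by metis
  have last: "(E ^^ (p - 1)) v \<in> W"
  proof -
    have "(E ^^ (p - 1)) v = (E ^^ (p - 1)) (ladder_comb v c) - scl M (c (Inr (p - 1)) * d) (F (E v))"
      by (simp only: d add_diff_cancel_right')
    then show ?thesis
      using vs.subspace_diff[OF subspace] vs.subspace_scale[OF subspace FE] pow(1)[OF w(1)] by metis
  qed
  have "(E ^^ i) v \<in> W" if "0 < i" "i < p" for i
  proof (rule inc_induct[of i "p - 1" "\<lambda>i. (E ^^ i) v \<in> W"])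
    fix n assume n: "i \<le> n" "n < p - 1" "(E ^^ Suc n) v \<in> W"
    have "scl M (- (qint p n * qint p (Suc n))) ((E ^^ n) v) \<in> W"
      using F_ladder_E_pow[OF v, of n] n that pow(2)[of "(E ^^ Suc n) v" 1] by simp
    then show "(E ^^ n) v \<in> W"
      by (rule cancel) (use n that qint_nonzero[of n p] qint_nonzero[of "Suc n" p] in auto)
  qed (use last that in auto)
  then show ?thesis
    using FE by simp
qed

end

context ladder_module
begin

text \<open>The map onto the trivial module takes the coefficient of t. A submodule that together
  with the kernel fills the module contains a vector with coefficient 1; by
  \<open>submodule_contains_E_pow\<close> and its mirror image it contains all other rungs, and
  therefore t.\<close>

lemma projective_cover_trivial:
  "projective_cover TYPE('m::ab_group_add) TYPE('n::ab_group_add) p M trivial_umod"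
proof -
  interpret T: umodule p trivial_umod
    using p_ge_2 u_module_trivial by (simp add: umodule_def)
  have "top_vector trivial_umod 1"
    by (simp add: top_vector_def trivial_umod_def)
  then obtain \<pi> where \<pi>: "umod_hom M trivial_umod \<pi>"
      "\<And>c. \<pi> (ladder_comb t c) = T.ladder_comb 1 c"
    using hom_exists[OF T.umodule_axioms] by blast
  have "ladder trivial_umod 1 k = (if k = Inl 0 then 1 else 0)" for k
    by (cases k rule: flip_rung.cases) (simp_all add: trivial_umod_def)
  then have "T.ladder_comb 1 c = c (Inl 0)" for c
    using p_ge_2 unfolding T.ladder_comb_def
    by (simp add: trivial_umod_def if_distrib[of "(*) _"] cong: if_cong)
  then have \<pi>_comb: "\<pi> (ladder_comb t c) = c (Inl 0)" for c
    by (simp add: \<pi>)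
  have "\<pi> ` carr M = carr trivial_umod"
  proof -
    have "z \<in> \<pi> ` carr M" for z
      using \<pi>_comb[of "\<lambda>_. z"] ladder_comb_carr[OF top, of "\<lambda>_. z"] by (metis image_eqI)
    then show ?thesis
      by (auto simp: trivial_umod_def)
  qed
  moreover have "W = carr M" if W: "u_submodule M W"
    and sum: "{w + k | w k. w \<in> W \<and> k \<in> carr M \<and> \<pi> k = 0} = carr M" for W
  proof -
    have subspace: "vs.subspace W" and "W \<subseteq> carr M"
      using W by (auto simp: u_submodule_def)
    have "t = ladder_comb t (\<lambda>k. if k = Inl 0 then 1 else 0)"
    proof -
      have "ladder_comb t (\<lambda>k. if k = Inl 0 then 1 else 0) =
          (\<Sum>k\<in>rungs p. if k = Inl 0 then t else 0)"
        unfolding ladder_comb_def by (rule sum.cong) auto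
      then show ?thesis
        using p_ge_2 by simp
    qed
    then have "\<pi> t = 1"
      using \<pi>_comb[of "\<lambda>k. if k = Inl 0 then 1 else 0"] by simp
    \<comment> \<open>Splitting t itself produces an element of \<open>W\<close> whose t-coefficient
      is 1.\<close>
    moreover obtain w k where wk: "t = w + k" "w \<in> W" "k \<in> carr M" "\<pi> k = 0"
      using sum t_carr by blast
    ultimately have \<pi>w: "\<pi> w = 1"
      using umod_linear_add[OF umod_hom_linear[OF \<pi>(1)], of w k] \<open>W \<subseteq> carr M\<close> by auto
    obtain c where c: "w = ladder_comb t c"
      using ladder_comb_exists wk(2) \<open>W \<subseteq> carr M\<close> by blast
    have c0: "c (Inl 0) = 1"
      using \<pi>w by (simp add: c \<pi>_comb)
    have E: "F (E t) \<in> W" "\<And>i. 0 < i \<Longrightarrow> i < p \<Longrightarrow> (E ^^ i) t \<in> W"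
      using submodule_contains_E_pow[OF top W, of c] c0 wk(2) c by simp_all
    have F: "(F ^^ i) t \<in> W" if "0 < i" "i < p" for i
      using umodule.submodule_contains_E_pow[OF umodule_swap top_vector_swap[OF top]
          u_submodule_swap[OF W], of "c \<circ> flip_rung"] wk(2) c c0 ladder_comb_swap[OF top, of c] that
      by simp
    have others: "ladder M t k \<in> W" if "k \<in> rungs p" "k \<noteq> Inl 0" for k
    proof (cases k)
      case (Inl i)
      then show ?thesis
        using that E(2)[of i] by auto
    next
      case (Inr i)
      then show ?thesis
        using that E(1) F[of i] by (cases i) auto
    qed
    have "w = t + (\<Sum>k\<in>rungs p - {Inl 0}. scl M (c k) (ladder M t k))"
      unfolding c ladder_comb_def using p_ge_2 c0 by (subst sum.remove[of _ "Inl 0"]) auto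
    moreover have "(\<Sum>k\<in>rungs p - {Inl 0}. scl M (c k) (ladder M t k)) \<in> W"
      by (intro vs.subspace_sum[OF subspace] vs.subspace_scale[OF subspace] others) auto
    ultimately have "t \<in> W"
      using vs.subspace_diff[OF subspace wk(2)] by (metis add_diff_cancel_right')
    then have "ladder M t ` rungs p \<subseteq> W"
      using others by (auto simp del: ladder_simps) (metis funpow_0 ladder_simps(1))
    then have "carr M \<subseteq> W"
      unfolding carr_eq by (rule vs.span_minimal[OF _ subspace])
    then show ?thesis
      using \<open>W \<subseteq> carr M\<close> by blast
  qed
  ultimately show ?thesis
    unfolding projective_cover_def
    by (intro conjI projective u_module_trivial exI[of _ \<pi>] \<pi>(1) allI impI) (use p_ge_2 in auto)
qed

end

section \<open>Submodules and uniqueness of projective covers\<close>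

lemma (in umodule) u_module_restrict:
  assumes "u_submodule M W"
  shows "u_module p (M\<lparr>carr := W\<rparr>)"
proof -
  have W: "vs.subspace W" "W \<subseteq> carr M"
      "\<And>w. w \<in> W \<Longrightarrow> E w \<in> W \<and> F w \<in> W \<and> K w \<in> W \<and> Ki w \<in> W"
    using assms by (auto simp: u_submodule_def)
  have "umod_linear (M\<lparr>carr := W\<rparr>) (M\<lparr>carr := W\<rparr>) f"
    if "umod_linear M M f" "\<And>w. w \<in> W \<Longrightarrow> f w \<in> W" for f
    using that W by (auto simp: umod_linear_def subset_eq)
  then have "umod_linear (M\<lparr>carr := W\<rparr>) (M\<lparr>carr := W\<rparr>) E" "umod_linear (M\<lparr>carr := W\<rparr>) (M\<lparr>carr := W\<rparr>) F"
    "umod_linear (M\<lparr>carr := W\<rparr>) (M\<lparr>carr := W\<rparr>) K" "umod_linear (M\<lparr>carr := W\<rparr>) (M\<lparr>carr := W\<rparr>) Ki"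
    using umod_linear_act W(3) by blast+
  then show ?thesis
    unfolding u_module_def using W(1,2) relations vs.vector_space_axioms by (auto simp: subset_eq)
qed

lemma umod_hom_id: "umod_hom M M (\<lambda>v. v)"
  by (simp add: umod_hom_def umod_linear_def)

lemma (in umodule) u_submodule_image:
  assumes N: "u_module p N" and h: "umod_hom M N h"
  shows "u_submodule N (h ` carr M)"
proof -
  interpret N: umodule p N
    using N p_ge_2 by (simp add: umodule_def)
  note lin = umod_hom_linear[OF h]
  have "N.vs.subspace (h ` carr M)"
  proof (rule N.vs.subspaceI)
    show "0 \<in> h ` carr M"
      using umod_linear_0[OF lin] carr_0 by (metis image_eqI)
  next
    fix x y assume "x \<in> h ` carr M" "y \<in> h ` carr M"
    then show "x + y \<in> h ` carr M"
      using umod_linear_add[OF lin] carr_add by (smt (verit) imageE image_eqI)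
  next
    fix c x assume "x \<in> h ` carr M"
    then show "scl N c x \<in> h ` carr M"
      using umod_linear_scale[OF lin] carr_scale by (smt (verit) imageE image_eqI)
  qed
  moreover have "actE N (h v) \<in> h ` carr M" "actF N (h v) \<in> h ` carr M"
      "actK N (h v) \<in> h ` carr M" "actKi N (h v) \<in> h ` carr M" if "v \<in> carr M" for v
    using umod_hom_act[OF h that] act_carr[OF that] by (metis image_eqI)+
  ultimately show ?thesis
    using umod_linear_carr[OF lin] by (auto simp: u_submodule_def)
qed

text \<open>Each x differs from some element of the image of h by an element of the kernel of \<pi>,
  so the image and the kernel together fill \<open>Q\<close>.\<close>

lemma (in umodule) superfluous_kernel:
  assumes Q: "u_module p Q" and h: "umod_hom M Q h" and \<pi>: "umod_hom Q T \<pi>"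
    and surj: "\<pi> ` (h ` carr M) = carr T"
    and superfluous: "\<forall>W. u_submodule Q W \<and>
      {w + k | w k. w \<in> W \<and> k \<in> carr Q \<and> \<pi> k = 0} = carr Q \<longrightarrow> W = carr Q"
  shows "h ` carr M = carr Q"
proof -
  interpret Q: umodule p Q
    using Q p_ge_2 by (simp add: umodule_def)
  have sub: "u_submodule Q (h ` carr M)"
    by (rule u_submodule_image[OF Q h])
  then have hQ: "h ` carr M \<subseteq> carr Q"
    by (simp add: u_submodule_def)
  have "x \<in> {w + k | w k. w \<in> h ` carr M \<and> k \<in> carr Q \<and> \<pi> k = 0}" if x: "x \<in> carr Q" for x
  proof -
    have "\<pi> x \<in> \<pi> ` (h ` carr M)"
      using surj umod_linear_carr[OF umod_hom_linear[OF \<pi>] x] by simp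
    then obtain w where w: "w \<in> h ` carr M" "\<pi> x = \<pi> w"
      by blast
    then have "x - w \<in> carr Q" "\<pi> (x - w) = 0"
      using x hQ Q.umod_linear_diff[OF umod_hom_linear[OF \<pi>]] by auto
    then show ?thesis
      using w(1) by (intro CollectI exI[of _ w] exI[of _ "x - w"]) simp
  qed
  then have "{w + k | w k. w \<in> h ` carr M \<and> k \<in> carr Q \<and> \<pi> k = 0} = carr Q"
    using hQ by auto
  then show ?thesis
    using superfluous sub by blast
qed

lemma projective_umod_lift:
  fixes M :: "'m::ab_group_add umod" and N :: "'n::ab_group_add umod"
  assumes "projective_umod TYPE('m) TYPE('n) p P" "u_module p M" "u_module p N"
    "umod_hom M N g" "g ` carr M = carr N" "umod_hom P N f"
  obtains h where "umod_hom P M h" "\<forall>v\<in>carr P. g (h v) = f v"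
proof -
  have "\<exists>h. umod_hom P M h \<and> (\<forall>v\<in>carr P. g (h v) = f v)"
    using assms(1)[unfolded projective_umod_def, THEN conjunct2, rule_format, of M N g f] assms(2-)
    by simp
  then show ?thesis
    using that by blast
qed

lemma projective_cover_unique:
  fixes P :: "'a::ab_group_add umod" and Q :: "'b::ab_group_add umod" and T :: "'t::ab_group_add umod"
  assumes p: "2 \<le> p"
    and P: "projective_cover TYPE('b) TYPE('t) p P T" and Q: "projective_cover TYPE('a) TYPE('b) p Q T"
  shows "umod_isomorphic P Q"
proof -
  have mods: "u_module p P" "u_module p Q" "u_module p T"
    using P Q by (auto simp: projective_cover_def projective_umod_def)
  interpret P: umodule p P
    using mods p by (simp add: umodule_def)
  interpret Q: umodule p Q
    using mods p by (simp add: umodule_def)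
  obtain \<pi>\<^sub>P where \<pi>\<^sub>P: "umod_hom P T \<pi>\<^sub>P" "\<pi>\<^sub>P ` carr P = carr T"
    "\<forall>W. u_submodule P W \<and> {w + k | w k. w \<in> W \<and> k \<in> carr P \<and> \<pi>\<^sub>P k = 0} = carr P \<longrightarrow> W = carr P"
    using P unfolding projective_cover_def by (elim conjE exE) (rule that; assumption)
  obtain \<pi>\<^sub>Q where \<pi>\<^sub>Q: "umod_hom Q T \<pi>\<^sub>Q" "\<pi>\<^sub>Q ` carr Q = carr T"
    "\<forall>W. u_submodule Q W \<and> {w + k | w k. w \<in> W \<and> k \<in> carr Q \<and> \<pi>\<^sub>Q k = 0} = carr Q \<longrightarrow> W = carr Q"
    using Q unfolding projective_cover_def by (elim conjE exE) (rule that; assumption)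
  obtain h where h: "umod_hom P Q h" "\<forall>v\<in>carr P. \<pi>\<^sub>Q (h v) = \<pi>\<^sub>P v"
    using P mods \<pi>\<^sub>P(1) \<pi>\<^sub>Q(1,2) by (auto simp: projective_cover_def elim: projective_umod_lift)
  have h_carr: "h ` carr P = carr Q"
    using P.superfluous_kernel[OF mods(2) h(1) \<pi>\<^sub>Q(1) _ \<pi>\<^sub>Q(3)] h(2) \<pi>\<^sub>P(2)
    by (simp add: image_image)
  obtain s where s: "umod_hom Q P s" "\<forall>v\<in>carr Q. h (s v) = v"
    using Q mods h(1) h_carr umod_hom_id[of Q] by (auto simp: projective_cover_def elim: projective_umod_lift)
  have "\<pi>\<^sub>P (s v) = \<pi>\<^sub>Q v" if "v \<in> carr Q" for v
    using h(2) s(2) umod_linear_carr[OF umod_hom_linear[OF s(1)] that] that by metis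
  then have s_carr: "s ` carr Q = carr P"
    using Q.superfluous_kernel[OF mods(1) s(1) \<pi>\<^sub>P(1) _ \<pi>\<^sub>P(3)] \<pi>\<^sub>Q(2)
    by (simp add: image_image)
  have "inj_on h (carr P)"
    using s(2) by (subst s_carr[symmetric]) (auto simp: inj_on_def)
  then show ?thesis
    unfolding umod_isomorphic_def bij_betw_def using h(1) h_carr by blast
qed

lemma (in umodule) u_submodule_span_ladder:
  assumes "top_vector M t"
  shows "u_submodule M (vs.span (ladder M t ` rungs p))" (is "u_submodule M ?S")
proof -
  have S: "?S \<subseteq> carr M"
    using ladder_carr[OF assms] by (intro vs.span_minimal subspace_carr) blast
  have closed: "f x \<in> ?S" if f: "umod_linear M M f"
    and l: "\<And>k. k \<in> rungs p \<Longrightarrow> \<exists>c. \<exists>j\<in>rungs p. f (ladder M t k) = scl M c (ladder M t j)"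
    and x: "x \<in> ?S" for f x
  proof -
    have "vs.subspace {x \<in> carr M. f x \<in> ?S}"
      by (rule vs.subspaceI) (simp_all add: umod_linear_0[OF f] umod_linear_add[OF f]
          umod_linear_scale[OF f] vs.span_zero vs.span_add vs.span_scale)
    moreover have "f (ladder M t k) \<in> ?S" if "k \<in> rungs p" for k
      using l[OF that] by (metis imageI vs.span_base vs.span_scale)
    ultimately have "?S \<subseteq> {x \<in> carr M. f x \<in> ?S}"
      using ladder_carr[OF assms] by (intro vs.span_minimal) auto
    then show ?thesis
      using x by blast
  qed
  have "E x \<in> ?S" if "x \<in> ?S" for x
    by (rule closed[OF umod_linear_act(1) _ that])
      (rule exI, rule bexI, erule E_ladder[OF assms], erule raise_in_rungs[OF p_ge_2])
  moreover have "F x \<in> ?S" if "x \<in> ?S" for x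
    by (rule closed[OF umod_linear_act(2) _ that])
      (rule exI, rule bexI, erule F_ladder[OF assms], erule lower_in_rungs[OF p_ge_2])
  moreover have "K x \<in> ?S" if "x \<in> ?S" for x
    by (rule closed[OF umod_linear_act(3) _ that]) (rule exI, rule bexI, rule K_ladder[OF assms])
  moreover have "Ki x \<in> ?S" if "x \<in> ?S" for x
    by (rule closed[OF umod_linear_act(4) _ that]) (rule exI, rule bexI, rule Ki_ladder[OF assms])
  ultimately show ?thesis
    using S by (simp add: u_submodule_def vs.subspace_span)
qed

section \<open>Operators on the quantum plane\<close>

lemma lookup_qscale [simp]:
  "Poly_Mapping.lookup (qscale c u) k = c * Poly_Mapping.lookup u k"
  by (simp add: qscale_def Poly_Mapping.map.rep_eq when_def)

lemma qscale_simps [simp]: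
  "qscale c (qscale d u) = qscale (c * d) u" "qscale 1 u = u" "qscale 0 u = 0" "qscale c 0 = 0"
  by (rule poly_mapping_eqI; simp add: algebra_simps)+

lemma qscale_add: "qscale c (u + v) = qscale c u + qscale c v"
  and qscale_left_add: "qscale (c + d) u = qscale c u + qscale d u"
  by (rule poly_mapping_eqI; simp add: lookup_add algebra_simps)+

lemma qscale_sum: "qscale c (\<Sum>i\<in>A. f i) = (\<Sum>i\<in>A. qscale c (f i))"
  by (induction A rule: infinite_finite_induct) (simp_all add: qscale_add)

definition qlinear :: "qop \<Rightarrow> bool" where
  "qlinear f \<longleftrightarrow> (\<forall>u v. f (u + v) = f u + f v) \<and> (\<forall>c u. f (qscale c u) = qscale c (f u))"

lemma qlinear_0: "qlinear f \<Longrightarrow> f 0 = 0"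
  unfolding qlinear_def by (metis qscale_simps(3))

lemma qlinear_sum: "qlinear f \<Longrightarrow> f (\<Sum>i\<in>A. g i) = (\<Sum>i\<in>A. f (g i))"
  by (induction A rule: infinite_finite_induct) (simp_all add: qlinear_0, simp add: qlinear_def)

lemma qlinear_scale: "qlinear f \<Longrightarrow> f (qscale c u) = qscale c (f u)"
  by (simp add: qlinear_def)

lemma qplane_expand:
  "u = (\<Sum>k\<in>Poly_Mapping.keys u. qscale (Poly_Mapping.lookup u k) (qxy (fst k) (snd k)))"
proof (rule poly_mapping_eqI)
  fix k
  have "Poly_Mapping.lookup (\<Sum>j\<in>Poly_Mapping.keys u. qscale (Poly_Mapping.lookup u j) (qxy (fst j) (snd j))) k =
      (\<Sum>j\<in>Poly_Mapping.keys u. if j = k then Poly_Mapping.lookup u j else 0)"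
    by (simp add: lookup_sum qxy_def lookup_single when_def if_distrib[of "(*) _"] cong: if_cong)
  then show "Poly_Mapping.lookup u k = Poly_Mapping.lookup (\<Sum>j\<in>Poly_Mapping.keys u. qscale (Poly_Mapping.lookup u j) (qxy (fst j) (snd j))) k"
    by (simp add: in_keys_iff)
qed

lemma qlinear_eqI:
  assumes "qlinear f" "qlinear g" "\<And>m n. f (qxy m n) = g (qxy m n)"
  shows "f = g"
proof
  fix u
  show "f u = g u"
    by (subst (1 2) qplane_expand)
      (simp add: qlinear_sum[OF assms(1)] qlinear_sum[OF assms(2)] qlinear_scale[OF assms(1)]
        qlinear_scale[OF assms(2)] assms(3))
qed

text \<open>A common finite index set makes the sums for u, v and u + v comparable although their
  supports differ.\<close>

lemma qlinext_superset:
  assumes "finite A" "Poly_Mapping.keys u \<subseteq> A"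
  shows "qlinext \<phi> u = (\<Sum>k\<in>A. qscale (Poly_Mapping.lookup u k) (\<phi> (fst k) (snd k)))"
  unfolding qlinext_def using assms by (intro sum.mono_neutral_left) (auto simp: in_keys_iff)

lemma qlinear_qlinext: "qlinear (qlinext \<phi>)"
  unfolding qlinear_def
proof (intro conjI allI)
  fix u v :: qplane
  let ?A = "Poly_Mapping.keys u \<union> Poly_Mapping.keys v"
  have "Poly_Mapping.keys (u + v) \<subseteq> ?A"
    by (rule Poly_Mapping.keys_add)
  then show "qlinext \<phi> (u + v) = qlinext \<phi> u + qlinext \<phi> v"
    by (simp add: qlinext_superset[of ?A] lookup_add qscale_left_add sum.distrib)
next
  fix c and u :: qplane
  have "Poly_Mapping.keys (qscale c u) \<subseteq> Poly_Mapping.keys u"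
    by (auto simp: in_keys_iff)
  then show "qlinext \<phi> (qscale c u) = qscale c (qlinext \<phi> u)"
    by (simp add: qlinext_superset[of "Poly_Mapping.keys u"] qscale_sum)
qed

lemma qlinext_qxy [simp]: "qlinext \<phi> (qxy m n) = \<phi> m n"
  by (simp add: qlinext_def qxy_def)

lemma qlinear_comp: "qlinear f \<Longrightarrow> qlinear g \<Longrightarrow> qlinear (f \<circ> g)"
  by (simp add: qlinear_def)

lemma qlinear_opscale: "qlinear f \<Longrightarrow> qlinear (opscale c f)"
  by (simp add: qlinear_def opscale_def qscale_add mult.commute)

lemma qlinear_dx: "qlinear (dx p)" and qlinear_dy: "qlinear (dy p)"
  by (simp_all add: dx_def dy_def qlinear_qlinext)

lemma dx_dy: "dx p \<circ> dy p = opscale (qroot p) (dy p \<circ> dx p)"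
proof (rule qlinear_eqI)
  fix m n
  let ?q = "qroot p"
  show "(dx p \<circ> dy p) (qxy m n) = opscale ?q (dy p \<circ> dx p) (qxy m n)"
  proof (cases "m = 0 \<or> n = 0")
    case True
    then show ?thesis
      by (auto simp: dx_def dy_def opscale_def qlinear_0[OF qlinear_qlinext]
          qlinear_scale[OF qlinear_qlinext])
  next
    case False
    then have "?q powi (- int m - int n + 1) * ?q powi (- int m - 2 * int (n - 1) + 1) =
      ?q powi 1 * (?q powi (- int m - 2 * int n + 1) * ?q powi (- int (m - 1) - int n + 1))"
      by (simp add: power_int_add [symmetric] of_nat_diff algebra_simps del: power_int_1_right)
    then show ?thesis
      using False by (simp add: dx_def dy_def opscale_def qlinear_scale[OF qlinear_qlinext])
  qed
qed (simp_all add: qlinear_comp qlinear_opscale qlinear_dx qlinear_dy)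

lemma qmult_scale_left: "qmult p (qscale c u) = opscale c (qmult p u)"
  by (simp add: fun_eq_iff qmult_def opscale_def qlinear_scale[OF qlinear_qlinext])

lemma qmult_0_left: "qmult p 0 = 0"
  by (simp add: fun_eq_iff qmult_def qlinear_0[OF qlinear_qlinext])

text \<open>In a generic parameter X^j and X^(-j) already differ at the coefficient of X^j. The
  factorials can thus be cancelled before evaluation at q, where [p] = 0.\<close>

lemma gen_qfact_nonzero: "gen_qfact n \<noteq> 0"
proof -
  have X: "(fls_X :: complex fls) ^ j - fls_X_inv ^ j \<noteq> 0" if "j > 0" for j
  proof
    assume "(fls_X :: complex fls) ^ j - fls_X_inv ^ j = 0"
    then have "fls_nth ((fls_X :: complex fls) ^ j) (int j) = fls_nth (fls_X_inv ^ j) (int j)"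
      by simp
    then show False
      using that by (simp add: fls_X_power_conv_shift_1 fls_X_inv_power_conv_shift_1)
  qed
  then have "gen_qint j \<noteq> 0" if "j > 0" for j
    using that X[of 1] by (simp add: gen_qint_def)
  then show ?thesis
    by (auto simp: gen_qfact_def)
qed

lemma laurent_eval_1: "laurent_eval 1 z = 1"
proof -
  have "{k. fls_nth (1 :: complex fls) k \<noteq> 0} = {0}"
    by auto
  then show ?thesis
    by (simp add: laurent_eval_def)
qed

lemma qbinom_0 [simp]: "qbinom p m 0 = 1" and qbinom_self [simp]: "qbinom p m m = 1"
  using gen_qfact_nonzero[of m] laurent_eval_1
  by (simp_all add: qbinom_def gen_qbinom_def) (simp_all add: gen_qfact_def)

text \<open>This exhibits the powers of the derivatives as monomials \<open>qmon\<close>, hence as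
  elements of the algebra.\<close>

lemma qmult_1_left: "qmult p (qxy 0 0) = id"
proof (rule qlinear_eqI)
  have "qmult p (qxy 0 0) = qlinext (\<lambda>r s. qxy r s)"
    by (simp add: fun_eq_iff qmult_def)
  then show "qlinear (qmult p (qxy 0 0))"
    by (simp add: qlinear_qlinext)
  show "qlinear id"
    by (simp add: qlinear_def)
qed (simp add: qmult_def)

section \<open>The action on quantum differential operators\<close>

lemma comp_opscale_left: "opscale c S \<circ> T = opscale c (S \<circ> T)"
  by (simp add: opscale_def fun_eq_iff)

lemma zero_comp: "(0 :: qop) \<circ> T = 0"
  by (simp add: fun_eq_iff)

lemma opscale_opscale [simp]: "opscale c (opscale d T) = opscale (c * d) T"
  by (simp add: opscale_def)

lemma opscale_1 [simp]: "opscale 1 T = T" and opscale_0 [simp]: "opscale 0 T = 0"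
  and opscale_zero [simp]: "opscale c 0 = 0"
  by (simp_all add: opscale_def fun_eq_iff)

locale qdiff_algebra =
  fixes p :: nat and D :: "qop umod"
  assumes p2: "2 \<le> p" and D: "is_qdiff_module_algebra p D"
begin

lemma module_algebra: "u_module_algebra p D (\<circ>) id"
  using D by (simp add: is_qdiff_module_algebra_def)

sublocale umodule p D
proof
  show "u_module p D"
    using module_algebra unfolding u_module_algebra_def by (elim conjE)
qed (fact p2)

lemma scl_D [simp]: "scl D = opscale"
  and carr_D: "carr D = qdiffops p"
  using D by (simp_all add: is_qdiff_module_algebra_def)

lemma vector_space_opscale: "vector_space opscale"
  using vs.vector_space_axioms by simp

lemma qmon_carr [simp]: "qmon p m n a b \<in> carr D"
  unfolding carr_D qdiffops_def
  by (rule module.span_base[OF vector_space_opscale[unfolded vector_space_def module_def[symmetric]]]) auto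

abbreviation X :: "nat \<Rightarrow> nat \<Rightarrow> qop" where
  "X m n \<equiv> qmult p (qxy m n)"

abbreviation X\<^sub>d :: "nat \<Rightarrow> qop" where
  "X\<^sub>d a \<equiv> dx p ^^ a"

abbreviation Y\<^sub>d :: "nat \<Rightarrow> qop" where
  "Y\<^sub>d b \<equiv> dy p ^^ b"

lemma X_carr [simp]: "X m n \<in> carr D"
  using qmon_carr[of m n 0 0] by (simp add: qmon_def)

lemma X\<^sub>d_carr [simp]: "X\<^sub>d a \<in> carr D"
  using qmon_carr[of 0 0 a 0] by (simp add: qmon_def qmult_1_left)

lemma Y\<^sub>d_carr [simp]: "Y\<^sub>d b \<in> carr D"
  using qmon_carr[of 0 0 0 b] by (simp add: qmon_def qmult_1_left)

lemma dx_carr [simp]: "dx p \<in> carr D" and dy_carr [simp]: "dy p \<in> carr D"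
  using X\<^sub>d_carr[of 1] Y\<^sub>d_carr[of 1] by simp_all

lemma umod_linear_comp_right: 
  assumes "S \<in> carr D"
  shows "umod_linear D D ((\<circ>) S)"
proof -
  have "\<forall>S\<in>carr D. umod_linear D D ((\<circ>) S)"
    using module_algebra unfolding u_module_algebra_def by (elim conjE)
  then show ?thesis
    using assms by (rule bspec)
qed

lemma comp_carr [simp]: "S \<in> carr D \<Longrightarrow> T \<in> carr D \<Longrightarrow> S \<circ> T \<in> carr D"
  by (rule umod_linear_carr[OF umod_linear_comp_right])

text \<open>The type \<open>qop\<close> contains non-linear functions; a scalar passes S because
  left composition with an element of the module algebra is linear on the carrier.\<close>

lemma comp_opscale: "S \<in> carr D \<Longrightarrow> T \<in> carr D \<Longrightarrow> S \<circ> opscale c T = opscale c (S \<circ> T)"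
  using umod_linear_scale[OF umod_linear_comp_right, of S T c] by simp

lemma comp_zero: "S \<in> carr D \<Longrightarrow> S \<circ> (0 :: qop) = 0"
  using umod_linear_0[OF umod_linear_comp_right, of S] by simp

lemma act_comp:
  assumes "S \<in> carr D" "T \<in> carr D"
  shows "E (S \<circ> T) = (E S \<circ> K T) + (S \<circ> E T)" "F (S \<circ> T) = (F S \<circ> T) + (Ki S \<circ> F T)"
    "K (S \<circ> T) = K S \<circ> K T" "Ki (S \<circ> T) = Ki S \<circ> Ki T"
proof -
  have "\<forall>u\<in>carr D. \<forall>v\<in>carr D. E (u \<circ> v) = (E u \<circ> K v) + (u \<circ> E v) \<and>
      F (u \<circ> v) = (F u \<circ> v) + (Ki u \<circ> F v) \<and> K (u \<circ> v) = K u \<circ> K v \<and> Ki (u \<circ> v) = Ki u \<circ> Ki v"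
    using module_algebra unfolding u_module_algebra_def by (elim conjE)
  note * = this[rule_format, OF assms]
  show "E (S \<circ> T) = (E S \<circ> K T) + (S \<circ> E T)" "F (S \<circ> T) = (F S \<circ> T) + (Ki S \<circ> F T)"
    "K (S \<circ> T) = K S \<circ> K T" "Ki (S \<circ> T) = Ki S \<circ> Ki T"
    by (rule *[THEN conjunct1] *[THEN conjunct2, THEN conjunct1]
        *[THEN conjunct2, THEN conjunct2, THEN conjunct1] *[THEN conjunct2, THEN conjunct2, THEN conjunct2])+
qed

lemma act_id: "E id = 0" "F id = 0" "K id = id" "Ki id = id"
  using module_algebra unfolding u_module_algebra_def by - (elim conjE, assumption)+

lemma act_d:
  "E (dx p) = opscale (- q) (dy p)" "E (dy p) = 0" "F (dx p) = 0"
  "F (dy p) = opscale (- inverse q) (dx p)"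
  "K (dx p) = opscale (inverse q) (dx p)" "K (dy p) = opscale q (dy p)"
  using D by (simp_all add: is_qdiff_module_algebra_def)

lemma act_X:
  "E (X m n) = (if n = 0 then 0 else opscale (qint p (m + 1)) (X (m + 1) (n - 1)))"
  "F (X m n) = (if m = 0 then 0 else opscale (qint p (n + 1)) (X (m - 1) (n + 1)))"
  "K (X m n) = opscale (q powi (int m - int n)) (X m n)"
  using D by (simp_all add: is_qdiff_module_algebra_def planeE_def planeF_def planeK_def
      qmult_scale_left qmult_0_left)

lemma Ki_eigen_op:
  "T \<in> carr D \<Longrightarrow> K T = opscale z T \<Longrightarrow> z \<noteq> 0 \<Longrightarrow> Ki T = opscale (inverse z) T"
  using Ki_eigen[of T z] by simp

lemma K_X\<^sub>d: "K (X\<^sub>d a) = opscale (inverse q ^ a) (X\<^sub>d a)"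
proof (induction a)
  case (Suc a)
  have "K (dx p \<circ> X\<^sub>d a) = opscale (inverse q ^ Suc a) (dx p \<circ> X\<^sub>d a)"
    by (simp add: act_comp act_d Suc.IH comp_opscale_left comp_opscale mult.commute)
  then show ?case
    by (simp only: funpow.simps)
qed (simp only: funpow.simps act_id power_0 opscale_1)

lemma K_Y\<^sub>d: "K (Y\<^sub>d b) = opscale (q ^ b) (Y\<^sub>d b)"
proof (induction b)
  case (Suc b)
  have "K (dy p \<circ> Y\<^sub>d b) = opscale (q ^ Suc b) (dy p \<circ> Y\<^sub>d b)"
    by (simp add: act_comp act_d Suc.IH comp_opscale_left comp_opscale mult.commute)
  then show ?case
    by (simp only: funpow.simps)
qed (simp only: funpow.simps act_id power_0 opscale_1)

lemma dy_dx: "dy p \<circ> dx p = opscale (inverse q) (dx p \<circ> dy p)"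
  by (simp add: dx_dy)

lemma dy_X\<^sub>d: "dy p \<circ> X\<^sub>d a = opscale (inverse q ^ a) (X\<^sub>d a \<circ> dy p)"
proof (induction a)
  case (Suc a)
  have "dy p \<circ> X\<^sub>d (Suc a) = (dy p \<circ> dx p) \<circ> X\<^sub>d a"
    by (simp add: o_assoc)
  also have "\<dots> = opscale (inverse q) (dx p \<circ> (dy p \<circ> X\<^sub>d a))"
    by (simp add: dy_dx comp_opscale_left o_assoc)
  also have "\<dots> = opscale (inverse q ^ Suc a) (X\<^sub>d (Suc a) \<circ> dy p)"
    by (simp only: Suc.IH comp_opscale[OF dx_carr comp_carr[OF X\<^sub>d_carr dy_carr]] opscale_opscale
        funpow.simps o_assoc power_Suc)
  finally show ?case .
qed (simp only: funpow.simps power_0 opscale_1 id_comp comp_id)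

text \<open>E replaces each factor \<open>dx p\<close> in turn by -q \<open>dy p\<close>. Moving it
  to the right end and the twist by K contribute powers q^(1-2j) for j < a, whose sum is q^(2-a)
  [a]. For a = 0 the truncated exponent is harmless because [0] = 0.\<close>

lemma E_X\<^sub>d: "E (X\<^sub>d a) = opscale (- (q ^ 2 * inverse q ^ a * qint p a)) (X\<^sub>d (a - 1) \<circ> dy p)"
proof (induction a)
  case (Suc a)
  note IH = Suc.IH
  have 1: "E (dx p) \<circ> K (X\<^sub>d a) = opscale (- (q * inverse q ^ (a + a))) (X\<^sub>d a \<circ> dy p)"
    by (simp add: act_d K_X\<^sub>d comp_opscale_left comp_opscale dy_X\<^sub>d power_add)
  have 2: "dx p \<circ> E (X\<^sub>d a) = opscale (- (q ^ 2 * inverse q ^ a * qint p a)) (X\<^sub>d a \<circ> dy p)"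
  proof (cases a)
    case 0
    then show ?thesis
      by (simp add: act_id comp_zero)
  next
    case (Suc a')
    then have "dx p \<circ> (X\<^sub>d (a - 1) \<circ> dy p) = X\<^sub>d a \<circ> dy p"
      by (simp add: o_assoc)
    then show ?thesis
      by (simp only: IH comp_opscale[OF dx_carr comp_carr[OF X\<^sub>d_carr dy_carr]])
  qed
  have "q * inverse q ^ (a + a) + q ^ 2 * inverse q ^ a * qint p a =
      q ^ 2 * inverse q ^ Suc a * qint p (Suc a)"
  proof -
    have "q ^ 2 * inverse q ^ Suc a * qint p (Suc a) = q * inverse q ^ a * (inverse q ^ a + q * qint p a)"
      using qint_add[of p a 1] p2 by (simp add: qint_1 power2_eq_square add.commute)
    then show ?thesis
      by (simp add: power2_eq_square power_add distrib_left mult_ac)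
  qed
  then have "- (q * inverse q ^ (a + a)) + - (q ^ 2 * inverse q ^ a * qint p a) =
      - (q ^ 2 * inverse q ^ Suc a * qint p (Suc a))"
    by (simp only: minus_add_distrib [symmetric])
  then have "E (dx p \<circ> X\<^sub>d a) = opscale (- (q ^ 2 * inverse q ^ Suc a * qint p (Suc a))) (X\<^sub>d a \<circ> dy p)"
    using vs.scale_left_distrib[of "- (q * inverse q ^ (a + a))"
        "- (q ^ 2 * inverse q ^ a * qint p a)" "X\<^sub>d a \<circ> dy p"]
    by (simp only: act_comp(1)[OF dx_carr X\<^sub>d_carr] 1 2 scl_D)
  then show ?case
    by (simp only: funpow.simps diff_Suc_1)
qed (simp only: funpow.simps act_id qint_0 mult_zero_right minus_zero opscale_0)

lemma E_Y\<^sub>d: "E (Y\<^sub>d b) = 0"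
  by (induction b)
    (simp_all only: funpow.simps act_id act_comp[OF dy_carr Y\<^sub>d_carr] act_d comp_zero[OF dy_carr]
      zero_comp add_0_left)

lemma F_X\<^sub>d: "F (X\<^sub>d a) = 0"
  by (induction a)
    (simp_all only: funpow.simps act_id act_comp[OF dx_carr X\<^sub>d_carr] act_d zero_comp add_0_left
      comp_zero[OF act_carr(4)[OF dx_carr]])

lemma Ki_dy: "Ki (dy p) = opscale (inverse q) (dy p)"
  by (rule Ki_eigen_op) (simp_all add: act_d)

lemma Ki_X\<^sub>d: "Ki (X\<^sub>d a) = opscale (q ^ a) (X\<^sub>d a)"
  using Ki_eigen_op[OF X\<^sub>d_carr K_X\<^sub>d, of a] by (simp add: power_inverse)

lemma Ki_X: "Ki (X m n) = opscale (q powi (int n - int m)) (X m n)"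
  using Ki_eigen_op[OF X_carr act_X(3), of m n] by (simp flip: power_int_minus)

text \<open>As in \<open>E_X\<^sub>d\<close>, with the new factor \<open>dx p\<close> moved to the
  left end so that the result is normally ordered.\<close>

lemma F_Y\<^sub>d: "F (Y\<^sub>d b) = opscale (- (inverse q ^ b * qint p b)) (dx p \<circ> Y\<^sub>d (b - 1))"
proof (induction b)
  case (Suc b)
  note IH = Suc.IH
  have 1: "F (dy p) \<circ> Y\<^sub>d b = opscale (- inverse q) (dx p \<circ> Y\<^sub>d b)"
    by (simp add: act_d comp_opscale_left)
  have 2: "Ki (dy p) \<circ> F (Y\<^sub>d b) = opscale (- (inverse q ^ Suc (Suc b) * qint p b)) (dx p \<circ> Y\<^sub>d b)"
  proof (cases b)
    case 0
    then show ?thesis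
      by (simp add: act_id comp_zero Ki_dy comp_opscale_left)
  next
    case (Suc b')
    then have "dy p \<circ> (dx p \<circ> Y\<^sub>d (b - 1)) = opscale (inverse q) (dx p \<circ> Y\<^sub>d b)"
      by (simp add: o_assoc dy_dx comp_opscale_left)
    then have "dy p \<circ> F (Y\<^sub>d b) = opscale (- (inverse q ^ b * qint p b) * inverse q) (dx p \<circ> Y\<^sub>d b)"
      by (simp only: IH comp_opscale[OF dy_carr comp_carr[OF dx_carr Y\<^sub>d_carr]] opscale_opscale)
    then show ?thesis
      by (simp add: Ki_dy comp_opscale_left mult_ac)
  qed
  have "inverse q + inverse q ^ Suc (Suc b) * qint p b = inverse q ^ Suc b * qint p (Suc b)"
  proof -
    have "inverse q ^ Suc b * qint p (Suc b) = inverse q ^ Suc b * (inverse q * qint p b + q ^ b)"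
      using qint_add'[of p b 1] p2 by (simp add: qint_1)
    also have "\<dots> = inverse q ^ Suc (Suc b) * qint p b + inverse q * (inverse q * q) ^ b"
      by (simp only: power_mult_distrib) (simp add: algebra_simps)
    finally show ?thesis
      by simp
  qed
  then have "- inverse q + - (inverse q ^ Suc (Suc b) * qint p b) = - (inverse q ^ Suc b * qint p (Suc b))"
    by (simp only: minus_add_distrib [symmetric])
  then have "F (dy p \<circ> Y\<^sub>d b) = opscale (- (inverse q ^ Suc b * qint p (Suc b))) (dx p \<circ> Y\<^sub>d b)"
    using vs.scale_left_distrib[of "- inverse q" "- (inverse q ^ Suc (Suc b) * qint p b)" "dx p \<circ> Y\<^sub>d b"]
    by (simp only: act_comp(2)[OF dy_carr Y\<^sub>d_carr] 1 2 scl_D)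
  then show ?case
    by (simp only: funpow.simps diff_Suc_1)
qed (simp only: funpow.simps act_id qint_0 mult_zero_right minus_zero opscale_0)

lemma qmon_eq: "qmon p m n a b = X m n \<circ> (X\<^sub>d a \<circ> Y\<^sub>d b)"
  by (simp add: qmon_def o_assoc)

text \<open>The two terms come from the summands E \<otimes> K and 1 \<otimes> E of the coproduct.
  Only n = 0 is split off: there n - 1 truncates while [m+1] need not vanish, whereas at a = 0 the
  factor [a] is zero.\<close>

lemma E_qmon:
  "E (qmon p m n a b) =
    (if n = 0 then 0 else opscale (qint p (m + 1) * q powi (int b - int a)) (qmon p (m + 1) (n - 1) a b)) -
    opscale (q powi (int b - int a + 2) * qint p a) (qmon p m n (a - 1) (b + 1))"
proof -
  have K: "K (X\<^sub>d a \<circ> Y\<^sub>d b) = opscale (q powi (int b - int a)) (X\<^sub>d a \<circ> Y\<^sub>d b)"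
    by (simp add: act_comp K_X\<^sub>d K_Y\<^sub>d comp_opscale_left comp_opscale power_int_diff divide_inverse
        power_inverse mult.commute)
  have "E (X\<^sub>d a \<circ> Y\<^sub>d b) = opscale (- (q powi (int b - int a + 2) * qint p a)) (X\<^sub>d (a - 1) \<circ> Y\<^sub>d (b + 1))"
    by (simp add: act_comp E_X\<^sub>d K_Y\<^sub>d E_Y\<^sub>d comp_opscale_left comp_opscale comp_zero power_int_diff
        power_int_add divide_inverse power_inverse mult_ac o_assoc)
  then have "X m n \<circ> E (X\<^sub>d a \<circ> Y\<^sub>d b) =
      opscale (- (q powi (int b - int a + 2) * qint p a)) (qmon p m n (a - 1) (b + 1))"
    by (simp only: comp_opscale[OF X_carr comp_carr[OF X\<^sub>d_carr Y\<^sub>d_carr]] qmon_eq)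
  also have "\<dots> = - opscale (q powi (int b - int a + 2) * qint p a) (qmon p m n (a - 1) (b + 1))"
    by (simp add: vs.scale_minus_left[simplified])
  finally have "X m n \<circ> E (X\<^sub>d a \<circ> Y\<^sub>d b) = \<dots>" .
  moreover have "E (X m n) \<circ> K (X\<^sub>d a \<circ> Y\<^sub>d b) =
      (if n = 0 then 0 else opscale (qint p (m + 1) * q powi (int b - int a)) (qmon p (m + 1) (n - 1) a b))"
    by (simp add: act_X K zero_comp comp_opscale_left comp_opscale qmon_eq)
  ultimately show ?thesis
    by (simp only: qmon_eq[of m n a b] act_comp(1)[OF X_carr comp_carr[OF X\<^sub>d_carr Y\<^sub>d_carr]]
        add_uminus_conv_diff)
qed

lemma F_qmon:
  "F (qmon p m n a b) =
    (if m = 0 then 0 else opscale (qint p (n + 1)) (qmon p (m - 1) (n + 1) a b)) -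
    opscale (q powi (int n - int m + int a - int b) * qint p b) (qmon p m n (a + 1) (b - 1))"
proof -
  have "X\<^sub>d a \<circ> (dx p \<circ> Y\<^sub>d (b - 1)) = X\<^sub>d (a + 1) \<circ> Y\<^sub>d (b - 1)"
    by (simp add: funpow_swap1 o_def fun_eq_iff)
  then have "F (X\<^sub>d a \<circ> Y\<^sub>d b) = opscale (- (q ^ a * inverse q ^ b * qint p b)) (X\<^sub>d (a + 1) \<circ> Y\<^sub>d (b - 1))"
    by (simp add: act_comp F_X\<^sub>d F_Y\<^sub>d Ki_X\<^sub>d zero_comp comp_opscale_left comp_opscale mult_ac)
  then have "Ki (X m n) \<circ> F (X\<^sub>d a \<circ> Y\<^sub>d b) =
      opscale (- (q powi (int n - int m) * (q ^ a * inverse q ^ b) * qint p b)) (qmon p m n (a + 1) (b - 1))"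
    by (simp add: Ki_X comp_opscale_left comp_opscale qmon_eq mult_ac)
  moreover have "q powi (int n - int m) * (q ^ a * inverse q ^ b) = q powi (int n - int m + int a - int b)"
    by (simp add: power_int_diff power_int_add divide_inverse power_inverse)
  ultimately have "Ki (X m n) \<circ> F (X\<^sub>d a \<circ> Y\<^sub>d b) =
      - opscale (q powi (int n - int m + int a - int b) * qint p b) (qmon p m n (a + 1) (b - 1))"
    by (simp add: vs.scale_minus_left[simplified])
  moreover have "F (X m n) \<circ> (X\<^sub>d a \<circ> Y\<^sub>d b) =
      (if m = 0 then 0 else opscale (qint p (n + 1)) (qmon p (m - 1) (n + 1) a b))"
    by (simp add: act_X comp_opscale_left qmon_eq zero_comp)
  ultimately show ?thesis
    by (simp only: qmon_eq[of m n a b] act_comp(2)[OF X_carr comp_carr[OF X\<^sub>d_carr Y\<^sub>d_carr]]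
        add_uminus_conv_diff)
qed

lemma K_qmon: "K (qmon p m n a b) = opscale (q powi (int m - int n - int a + int b)) (qmon p m n a b)"
proof -
  have "K (qmon p m n a b) = opscale (q powi (int m - int n)) (X m n) \<circ>
      (opscale (inverse q ^ a) (X\<^sub>d a) \<circ> opscale (q ^ b) (Y\<^sub>d b))"
    by (simp only: qmon_eq act_comp(3) X_carr comp_carr X\<^sub>d_carr Y\<^sub>d_carr act_X K_X\<^sub>d K_Y\<^sub>d)
  also have "\<dots> = opscale (q powi (int m - int n) * (inverse q ^ a * q ^ b)) (qmon p m n a b)"
    by (simp only: comp_opscale_left comp_opscale X_carr comp_carr X\<^sub>d_carr Y\<^sub>d_carr opscale_opscale qmon_eq)
  also have "q powi (int m - int n) * (inverse q ^ a * q ^ b) = q powi (int m - int n - int a + int b)"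
    by (simp add: power_int_diff power_int_add divide_inverse power_inverse)
  finally show ?thesis .
qed

end

section \<open>The ladder of the element \<open>\<tau>\<close>\<close>

lemma qroot_powi_mod_p:
  assumes "p > 0" "k = int n - int p"
  shows "qroot p powi k = - (qroot p ^ n)"
  using assms by (simp add: power_int_diff qroot_power_p)

lemma sum_shift_down:
  fixes g :: "nat \<Rightarrow> 'a::comm_monoid_add"
  assumes "g 1 = 0"
  shows "(\<Sum>i=1..Suc r. g i) = (\<Sum>i=1..r. g (Suc i))"
  using assms by (subst sum.atLeast_Suc_atMost) (simp_all only: One_nat_def sum.shift_bounds_cl_Suc_ivl, simp_all)

context qdiff_algebra
begin

text \<open>For 1 \<le> i \<le> p - k these are the monomials of E^k \<tau>; they have weight
  q^(2k).\<close>

definition L :: "nat \<Rightarrow> nat \<Rightarrow> qop" where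
  "L k i = qmon p (p - i) (i - 1) (p - i - k) (i + k - 1)"

text \<open>The monomials of F^k \<tau>, of weight q^(-2k). The indexing runs opposite to that of
  \<open>L\<close>: \<open>R 0 i\<close> is \<open>L 0 (p + 1 - i)\<close>, which makes the
  coefficients on the F side geometric in i.\<close>

definition R :: "nat \<Rightarrow> nat \<Rightarrow> qop" where
  "R k i = qmon p (i - 1) (p - i) (i + k - 1) (p - i - k)"

lemma L_carr [simp]: "L k i \<in> carr D" and R_carr [simp]: "R k i \<in> carr D"
  by (simp_all add: L_def R_def)

lemma p_pos: "p > 0"
  using p2 by simp

lemma opscale_minus_left: "opscale (- c) T = - opscale c T"
  using vs.scale_minus_left by simp

lemma opscale_sum: "opscale c (\<Sum>i\<in>A. f i) = (\<Sum>i\<in>A. opscale c (f i))"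
  using vs.scale_sum_right by simp

lemma opscale_diff_left: "opscale (c - d) T = opscale c T - opscale d T"
  using vs.scale_left_diff_distrib by simp

lemma opscale_diff_right: "opscale c (S - T) = opscale c S - opscale c T"
  using vs.scale_right_diff_distrib by simp

lemma act_opscale:
  assumes "T \<in> carr D"
  shows "E (opscale c T) = opscale c (E T)" "F (opscale c T) = opscale c (F T)"
    "K (opscale c T) = opscale c (K T)"
  using act_scale[of T c] assms by simp_all

lemma carr_opscale [simp]: "T \<in> carr D \<Longrightarrow> opscale c T \<in> carr D"
  using carr_scale by simp

text \<open>The relations q^p = -1 and [p - n] = [n] remove p from all coefficients. The indices
  outside the range, reached at i = 1 and at i + k = p, occur with coefficients [0] and [p].\<close>

lemma E_L:
  assumes "1 \<le> i" "i + k \<le> p"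
  shows "E (L k i) = opscale (q ^ (2 * i + 2 * k + 1) * qint p (i + k)) (L (Suc k) i) -
    opscale (q ^ (2 * i + 2 * k - 1) * qint p (i - 1)) (L (Suc k) (i - 1))"
proof -
  have 1: "qint p (p - i - k) = qint p (i + k)"
    using qint_reflect[of "i + k" p] assms p_pos by (simp add: diff_diff_add)
  have 2: "q powi (int (i + k - 1) - int (p - i - k) + 2) = - (q ^ (2 * i + 2 * k + 1))"
    using assms p_pos by (intro qroot_powi_mod_p) (simp_all add: of_nat_diff)
  have 3: "q powi (int (i + k - 1) - int (p - i - k)) = - (q ^ (2 * i + 2 * k - 1))"
    using assms p_pos by (intro qroot_powi_mod_p) (simp_all add: of_nat_diff)
  have 4: "qmon p (p - i) (i - 1) (p - i - k - 1) (i + k - 1 + 1) = L (Suc k) i"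
    using assms by (simp add: L_def)
  show ?thesis
  proof (cases "i = 1")
    case True
    then show ?thesis
      using assms 1 2 4 unfolding L_def[of k] E_qmon by (simp add: opscale_minus_left)
  next
    case False
    have 5: "qint p (p - i + 1) = qint p (i - 1)"
      using qint_reflect[of "i - 1" p] assms p_pos by (simp add: Suc_diff_le)
    have 6: "qmon p (p - i + 1) (i - 1 - 1) (p - i - k) (i + k - 1) = L (Suc k) (i - 1)"
      using assms False by (simp add: L_def Suc_diff_le)
    show ?thesis
      using False assms unfolding L_def[of k] E_qmon 1 2 3 4 5 6
      by (simp add: opscale_minus_left mult.commute)
  qed
qed

lemma F_R:
  assumes "1 \<le> i" "i + k \<le> p"
  shows "F (R k i) = opscale (qint p (i - 1)) (R (Suc k) (i - 1)) -
    opscale (q ^ (2 * k) * qint p (i + k)) (R (Suc k) i)"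
proof -
  have 1: "qint p (p - i - k) = qint p (i + k)"
    using qint_reflect[of "i + k" p] assms p_pos by (simp add: diff_diff_add)
  have "int (p - i) - int (i - 1) + int (i + k - 1) - int (p - i - k) = int (2 * k)"
    using assms by (simp add: of_nat_diff)
  then have 2: "q powi (int (p - i) - int (i - 1) + int (i + k - 1) - int (p - i - k)) = q ^ (2 * k)"
    by (simp only: power_int_of_nat)
  have 4: "qmon p (i - 1) (p - i) (i + k - 1 + 1) (p - i - k - 1) = R (Suc k) i"
    using assms by (simp add: R_def)
  have 5: "qint p (p - i + 1) = qint p (i - 1)"
    using qint_reflect[of "i - 1" p] assms p_pos by (simp add: Suc_diff_le)
  have 6: "qmon p (i - 1 - 1) (p - i + 1) (i + k - 1) (p - i - k) = R (Suc k) (i - 1)" if "i \<noteq> 1"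
    using assms that by (simp add: R_def Suc_diff_le)
  show ?thesis
    using assms 6 unfolding R_def[of k] F_qmon 1 2 4 5 by (cases "i = 1") auto
qed

lemma F_L_1:
  assumes "1 \<le> i" "i < p"
  shows "F (L 1 i) = opscale (qint p i) (L 0 (Suc i)) - opscale (inverse q ^ 2 * qint p i) (L 0 i)"
proof -
  have "int (i - 1) - int (p - i) + int (p - i - 1) - int i = - int 2"
    using assms by (simp add: of_nat_diff)
  then have 1: "q powi (int (i - 1) - int (p - i) + int (p - i - 1) - int i) = inverse q ^ 2"
    by (simp only: power_int_minus power_int_of_nat power_inverse)
  have "F (L 1 i) = F (qmon p (p - i) (i - 1) (p - i - 1) i)"
    by (simp add: L_def)
  also have "\<dots> = opscale (qint p (i - 1 + 1)) (qmon p (p - i - 1) (i - 1 + 1) (p - i - 1) i) -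
      opscale (inverse q ^ 2 * qint p i) (qmon p (p - i) (i - 1) (p - i - 1 + 1) (i - 1))"
    using assms unfolding F_qmon 1 by simp
  also have "\<dots> = opscale (qint p i) (L 0 (Suc i)) - opscale (inverse q ^ 2 * qint p i) (L 0 i)"
    using assms by (simp add: L_def Suc_diff_Suc)
  finally show ?thesis .
qed

text \<open>Collecting terms reduces E to a recursion on coefficient sequences. The two boundary
  terms vanish by [p] = 0 and [0] = 0, which is why the range loses one index.\<close>

lemma E_sum_L:
  assumes "k < p"
  shows "E (\<Sum>i=1..p - k. opscale (s i) (L k i)) =
    (\<Sum>i=1..p - Suc k. opscale (q ^ (2 * i + 2 * k + 1) * (qint p (i + k) * s i - qint p i * s (Suc i)))
      (L (Suc k) i))"
proof -
  obtain r where r: "p - k = Suc r" "p - Suc k = r"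
    using assms by (metis Suc_diff_Suc)
  have p: "Suc (k + r) = p"
    using r assms by simp
  let ?f = "\<lambda>i. opscale (s i * (q ^ (2 * i + 2 * k + 1) * qint p (i + k))) (L (Suc k) i)"
  let ?g = "\<lambda>i. opscale (s i * (q ^ (2 * i + 2 * k - 1) * qint p (i - 1))) (L (Suc k) (i - 1))"
  have "E (\<Sum>i=1..p - k. opscale (s i) (L k i)) = (\<Sum>i=1..p - k. opscale (s i) (E (L k i)))"
    by (simp add: act_sum act_opscale)
  also have "\<dots> = (\<Sum>i=1..p - k. ?f i - ?g i)"
    using assms by (intro sum.cong refl, subst E_L) (auto simp: opscale_diff_right)
  also have "\<dots> = (\<Sum>i=1..Suc r. ?f i) - (\<Sum>i=1..Suc r. ?g i)"
    by (simp only: r sum_subtractf)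
  also have "(\<Sum>i=1..Suc r. ?f i) = (\<Sum>i=1..r. ?f i)"
    using qint_p[OF p_pos] by (subst sum.cl_ivl_Suc) (simp del: sum.cl_ivl_Suc add: add.commute p)
  also have "(\<Sum>i=1..Suc r. ?g i) = (\<Sum>i=1..r. ?g (Suc i))"
    by (rule sum_shift_down) simp
  also have "(\<Sum>i=1..r. ?f i) - (\<Sum>i=1..r. ?g (Suc i)) =
      (\<Sum>i=1..r. opscale (q ^ (2 * i + 2 * k + 1) * (qint p (i + k) * s i - qint p i * s (Suc i)))
        (L (Suc k) i))"
    unfolding sum_subtractf [symmetric] opscale_diff_left [symmetric]
    by (intro sum.cong refl) (simp add: algebra_simps flip: opscale_diff_left)
  finally show ?thesis
    by (simp only: r)
qed

lemma F_sum_R: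
  assumes "k < p"
  shows "F (\<Sum>i=1..p - k. opscale (s i) (R k i)) =
    (\<Sum>i=1..p - Suc k. opscale (qint p i * s (Suc i) - q ^ (2 * k) * qint p (i + k) * s i) (R (Suc k) i))"
proof -
  obtain r where r: "p - k = Suc r" "p - Suc k = r"
    using assms by (metis Suc_diff_Suc)
  have p: "Suc (k + r) = p"
    using r assms by simp
  let ?f = "\<lambda>i. opscale (s i * (q ^ (2 * k) * qint p (i + k))) (R (Suc k) i)"
  let ?g = "\<lambda>i. opscale (s i * qint p (i - 1)) (R (Suc k) (i - 1))"
  have "F (\<Sum>i=1..p - k. opscale (s i) (R k i)) = (\<Sum>i=1..p - k. opscale (s i) (F (R k i)))"
    by (simp add: act_sum act_opscale)
  also have "\<dots> = (\<Sum>i=1..p - k. ?g i - ?f i)"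
    using assms by (intro sum.cong refl, subst F_R) (auto simp: opscale_diff_right)
  also have "\<dots> = (\<Sum>i=1..Suc r. ?g i) - (\<Sum>i=1..Suc r. ?f i)"
    by (simp only: r sum_subtractf)
  also have "(\<Sum>i=1..Suc r. ?f i) = (\<Sum>i=1..r. ?f i)"
    using qint_p[OF p_pos] by (subst sum.cl_ivl_Suc) (simp del: sum.cl_ivl_Suc add: add.commute p)
  also have "(\<Sum>i=1..Suc r. ?g i) = (\<Sum>i=1..r. ?g (Suc i))"
    by (rule sum_shift_down) simp
  also have "(\<Sum>i=1..r. ?g (Suc i)) - (\<Sum>i=1..r. ?f i) =
      (\<Sum>i=1..r. opscale (qint p i * s (Suc i) - q ^ (2 * k) * qint p (i + k) * s i) (R (Suc k) i))"
    unfolding sum_subtractf [symmetric] opscale_diff_left [symmetric]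
    by (intro sum.cong refl) (simp add: algebra_simps flip: opscale_diff_left)
  finally show ?thesis
    by (simp only: r)
qed


section \<open>Powers of E and F on \<tau>, and the socle element \<beta>\<close>

definition tau :: "complex \<Rightarrow> complex \<Rightarrow> qop" where
  "tau C \<alpha> = opscale (- (C * q)) (\<Sum>i=1..p. opscale (acoeff p \<alpha> i) (L 0 i))"

lemma tau_carr [simp]: "tau C \<alpha> \<in> carr D"
  unfolding tau_def by (intro carr_opscale carr_sum) simp

text \<open>The a_i are built for this increment: multiplied by [i] it is a pure power of q, and
  \<alpha> has dropped out.\<close>

lemma acoeff_Suc:
  assumes "i \<ge> 1"
  shows "acoeff p \<alpha> (Suc i) = acoeff p \<alpha> i + inverse q ^ i / qint p i"
  using assms by (simp add: acoeff_def power_int_minus power_inverse)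

lemma qfact_Suc: "qfact p (Suc n) = qfact p n * qint p (Suc n)"
  by (simp add: qfact_def)

text \<open>From k = 1 on the coefficients are geometric in i, and \<open>E_sum_L\<close> preserves
  this: [i+k] - q^k [i] = q^(-i) [k]. Each step contributes one factor of the q-factorial and raises
  k^2 to (k+1)^2 in the exponent.\<close>

lemma E_pow_tau:
  assumes "1 \<le> k" "k < p"
  shows "(E ^^ k) (tau C \<alpha>) =
    (\<Sum>i=1..p - k. opscale (C * q ^ (k\<^sup>2 + 1) * qfact p (k - 1) * q ^ (k * i)) (L k i))"
  using assms
proof (induction k rule: nat_induct_at_least)
  case base
  have "E (tau C \<alpha>) = opscale (- (C * q)) (E (\<Sum>i=1..p - 0. opscale (acoeff p \<alpha> i) (L 0 i)))"
    unfolding tau_def by (subst act_opscale) (auto intro!: carr_sum)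
  also have "\<dots> = (\<Sum>i=1..p - 1. opscale (- (C * q) * (q ^ (2 * i + 1) *
      (qint p i * acoeff p \<alpha> i - qint p i * acoeff p \<alpha> (Suc i)))) (L 1 i))"
    by (subst E_sum_L[OF p_pos]) (simp add: opscale_sum)
  also have "\<dots> = (\<Sum>i=1..p - 1. opscale (C * q ^ (1\<^sup>2 + 1) * qfact p (1 - 1) * q ^ (1 * i)) (L 1 i))"
  proof (intro sum.cong refl arg_cong2[where f = opscale])
    fix i assume i: "i \<in> {1..p - 1}"
    then have "qint p i \<noteq> 0"
      by (intro qint_nonzero) auto
    then have "qint p i * acoeff p \<alpha> i - qint p i * acoeff p \<alpha> (Suc i) = - (inverse q ^ i)"
      using i by (simp add: acoeff_Suc field_simps)
    then show "- (C * q) * (q ^ (2 * i + 1) * (qint p i * acoeff p \<alpha> i - qint p i * acoeff p \<alpha> (Suc i))) =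
        C * q ^ (1\<^sup>2 + 1) * qfact p (1 - 1) * q ^ (1 * i)"
      by (simp add: qfact_def power_add mult_2 power_inverse power2_eq_square)
  qed
  finally show ?case
    by simp
next
  case (Suc k)
  let ?A = "C * q ^ (k\<^sup>2 + 1) * qfact p (k - 1)"
  have "(E ^^ Suc k) (tau C \<alpha>) = E (\<Sum>i=1..p - k. opscale (?A * q ^ (k * i)) (L k i))"
    using Suc by simp
  also have "\<dots> = (\<Sum>i=1..p - Suc k. opscale (q ^ (2 * i + 2 * k + 1) *
      (qint p (i + k) * (?A * q ^ (k * i)) - qint p i * (?A * q ^ (k * Suc i)))) (L (Suc k) i))"
    using Suc.prems by (intro E_sum_L) simp
  also have "\<dots> = (\<Sum>i=1..p - Suc k. opscale (C * q ^ ((Suc k)\<^sup>2 + 1) * qfact p (Suc k - 1) * q ^ (Suc k * i)) (L (Suc k) i))"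
  proof (intro sum.cong refl arg_cong2[where f = opscale])
    fix i
    have "q ^ (2 * i + 2 * k + 1) * (qint p (i + k) * (?A * q ^ (k * i)) - qint p i * (?A * q ^ (k * Suc i))) =
        ?A * q ^ (k * i) * qint p k * (q ^ (2 * i + 2 * k + 1) * inverse q ^ i)"
      by (simp add: qint_add[of p i k] power_add algebra_simps)
    also have "q ^ (2 * i + 2 * k + 1) * inverse q ^ i = q ^ (i + 2 * k + 1)"
      by (simp add: power_add mult_2 power_inverse)
    also have "?A * q ^ (k * i) * qint p k * q ^ (i + 2 * k + 1) =
        C * (q ^ (k\<^sup>2 + 1) * q ^ (k * i) * q ^ (i + 2 * k + 1)) * (qfact p (k - 1) * qint p k)"
      by (simp add: mult_ac)
    also have "qfact p (k - 1) * qint p k = qfact p (Suc k - 1)"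
      using qfact_Suc[of "k - 1"] Suc.hyps by simp
    also have "q ^ (k\<^sup>2 + 1) * q ^ (k * i) * q ^ (i + 2 * k + 1) = q ^ ((Suc k)\<^sup>2 + 1) * q ^ (Suc k * i)"
      unfolding power_add [symmetric] by (rule arg_cong[of _ _ "\<lambda>n. q ^ n"]) (simp add: power2_eq_square)
    finally show "q ^ (2 * i + 2 * k + 1) *
        (qint p (i + k) * (?A * q ^ (k * i)) - qint p i * (?A * q ^ (k * Suc i))) =
        C * q ^ ((Suc k)\<^sup>2 + 1) * qfact p (Suc k - 1) * q ^ (Suc k * i)"
      by (simp add: mult_ac)
  qed
  finally show ?case .
qed

lemma tau_eq_sum_R: "tau C \<alpha> = opscale (- (C * q)) (\<Sum>i=1..p. opscale (acoeff p \<alpha> (Suc p - i)) (R 0 i))"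
proof -
  have "(\<Sum>i=1..p. opscale (acoeff p \<alpha> i) (L 0 i)) =
      (\<Sum>i=1..p. opscale (acoeff p \<alpha> (1 + p - i)) (L 0 (1 + p - i)))"
    by (subst sum.atLeastAtMost_rev) (simp add: add.commute)
  also have "\<dots> = (\<Sum>i=1..p. opscale (acoeff p \<alpha> (Suc p - i)) (R 0 i))"
  proof (intro sum.cong refl arg_cong2[where f = opscale])
    fix i assume "i \<in> {1..p}"
    then have "p - (1 + p - i) = i - 1" "1 + p - i - 1 = p - i"
      by auto
    then show "L 0 (1 + p - i) = R 0 i"
      by (simp add: L_def R_def)
  qed simp
  finally show ?thesis
    by (simp add: tau_def)
qed

text \<open>In the reversed indexing the coefficients are again geometric; the step rests on q^k
  [i+k] = [i] + q^(i+k) [k], where the [i] terms cancel and leave a sign.\<close>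

lemma F_pow_tau:
  assumes "1 \<le> k" "k < p"
  shows "(F ^^ k) (tau C \<alpha>) =
    (\<Sum>i=1..p - k. opscale ((- 1) ^ k * C * q ^ (k * (k - 1) + 1) * qfact p (k - 1) * q ^ (k * i)) (R k i))"
  using assms
proof (induction k rule: nat_induct_at_least)
  case base
  have "F (tau C \<alpha>) = opscale (- (C * q)) (F (\<Sum>i=1..p - 0. opscale (acoeff p \<alpha> (Suc p - i)) (R 0 i)))"
    unfolding tau_eq_sum_R by (subst act_opscale) (auto intro!: carr_sum)
  also have "\<dots> = (\<Sum>i=1..p - 1. opscale (- (C * q) *
      (qint p i * acoeff p \<alpha> (Suc p - Suc i) - qint p i * acoeff p \<alpha> (Suc p - i))) (R 1 i))"
    by (subst F_sum_R[OF p_pos]) (simp add: opscale_sum)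
  also have "\<dots> = (\<Sum>i=1..p - 1. opscale ((- 1) ^ 1 * C * q ^ (1 * (1 - 1) + 1) * qfact p (1 - 1) * q ^ (1 * i)) (R 1 i))"
  proof (intro sum.cong refl arg_cong2[where f = opscale])
    fix i assume i: "i \<in> {1..p - 1}"
    \<comment> \<open>After reversal the increment of the a's is q^(-(p-i)) / [p-i]; reflection
      turns [p-i] into [i], and q^p = -1 turns the power into -q^i.\<close>
    then have "qint p (p - i) \<noteq> 0"
      by (intro qint_nonzero) auto
    moreover have "qint p (p - i) = qint p i"
      using i p_pos by (intro qint_reflect) auto
    moreover have "Suc p - i = Suc (p - i)" "Suc p - Suc i = p - i" "1 \<le> p - i"
      using i by auto
    ultimately have "qint p i * acoeff p \<alpha> (Suc p - Suc i) - qint p i * acoeff p \<alpha> (Suc p - i) = - (inverse q ^ (p - i))"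
      by (simp add: acoeff_Suc field_simps)
    moreover have "inverse q ^ (p - i) = - (q ^ i)"
    proof -
      have "q ^ (p - i) * - (q ^ i) = 1"
      proof -
        have "p - i + i = p"
          using i by auto
        then show ?thesis
          using qroot_power_p[OF p_pos] by (simp flip: power_add)
      qed
      then show ?thesis
        unfolding power_inverse by (rule inverse_unique)
    qed
    ultimately show "- (C * q) * (qint p i * acoeff p \<alpha> (Suc p - Suc i) - qint p i * acoeff p \<alpha> (Suc p - i)) =
        (- 1) ^ 1 * C * q ^ (1 * (1 - 1) + 1) * qfact p (1 - 1) * q ^ (1 * i)"
      by (simp add: qfact_def)
  qed
  finally show ?case
    by simp
next
  case (Suc k)
  let ?A = "(- 1) ^ k * C * q ^ (k * (k - 1) + 1) * qfact p (k - 1)"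
  have "(F ^^ Suc k) (tau C \<alpha>) = F (\<Sum>i=1..p - k. opscale (?A * q ^ (k * i)) (R k i))"
    using Suc by simp
  also have "\<dots> = (\<Sum>i=1..p - Suc k. opscale
      (qint p i * (?A * q ^ (k * Suc i)) - q ^ (2 * k) * qint p (i + k) * (?A * q ^ (k * i))) (R (Suc k) i))"
    using Suc.prems by (intro F_sum_R) simp
  also have "\<dots> = (\<Sum>i=1..p - Suc k. opscale ((- 1) ^ Suc k * C * q ^ (Suc k * (Suc k - 1) + 1) *
      qfact p (Suc k - 1) * q ^ (Suc k * i)) (R (Suc k) i))"
  proof (intro sum.cong refl arg_cong2[where f = opscale])
    fix i
    have "q ^ k * qint p (i + k) = qint p i + q ^ (i + k) * qint p k"
      using qint_add'[of p i k] by (simp add: power_add power_inverse distrib_left)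
    then have "q ^ (2 * k) * qint p (i + k) = q ^ k * (qint p i + q ^ (i + k) * qint p k)"
      by (simp add: mult_2 power_add mult.assoc)
    then have "qint p i * (?A * q ^ (k * Suc i)) - q ^ (2 * k) * qint p (i + k) * (?A * q ^ (k * i)) =
        - (?A * (q ^ (k * i) * q ^ k * q ^ (i + k)) * qint p k)"
      by (simp add: power_add algebra_simps)
    also have "\<dots> = (- 1) ^ Suc k * C * (q ^ (k * (k - 1) + 1) * (q ^ (k * i) * q ^ k * q ^ (i + k))) *
        (qfact p (k - 1) * qint p k)"
      by (simp add: mult_ac)
    also have "qfact p (k - 1) * qint p k = qfact p (Suc k - 1)"
      using qfact_Suc[of "k - 1"] Suc.hyps by simp
    also have "q ^ (k * (k - 1) + 1) * (q ^ (k * i) * q ^ k * q ^ (i + k)) =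
        q ^ (Suc k * (Suc k - 1) + 1) * q ^ (Suc k * i)"
      unfolding power_add [symmetric] using Suc.hyps
      by (intro arg_cong[of _ _ "\<lambda>n. q ^ n"]) (cases k; simp add: algebra_simps)
    finally show "qint p i * (?A * q ^ (k * Suc i)) - q ^ (2 * k) * qint p (i + k) * (?A * q ^ (k * i)) =
        (- 1) ^ Suc k * C * q ^ (Suc k * (Suc k - 1) + 1) * qfact p (Suc k - 1) * q ^ (Suc k * i)"
      by (simp add: mult_ac)
  qed
  finally show ?case .
qed

lemma FE_tau: "F (E (tau C \<alpha>)) = opscale (- (C * q)) (\<Sum>i=1..p. L 0 i)"
proof -
  obtain r where r: "p = Suc r"
    using p_pos gr0_conv_Suc by blast
  let ?g = "\<lambda>i. opscale (C * q ^ (i + 1) * qint p (i - 1)) (L 0 i)"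
  let ?f = "\<lambda>i. opscale (C * q ^ i * qint p i) (L 0 i)"
  have "F (E (tau C \<alpha>)) = F (\<Sum>i=1..r. opscale (C * q ^ (i + 2)) (L 1 i))"
    using E_pow_tau[of 1 C \<alpha>] p2 r by (simp add: qfact_def power_add power2_eq_square mult_ac)
  also have "\<dots> = (\<Sum>i=1..r. opscale (C * q ^ (i + 2)) (F (L 1 i)))"
    by (simp add: act_sum act_opscale del: One_nat_def)
  also have "\<dots> = (\<Sum>i=1..r. ?g (Suc i) - ?f i)"
  proof (intro sum.cong refl)
    fix i assume "i \<in> {1..r}"
    then have "F (L 1 i) = opscale (qint p i) (L 0 (Suc i)) - opscale (inverse q ^ 2 * qint p i) (L 0 i)"
      using r by (intro F_L_1) auto
    moreover have "C * q ^ (i + 2) * (inverse q ^ 2 * qint p i) = C * q ^ i * qint p i"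
    proof -
      have "C * q ^ (i + 2) * (inverse q ^ 2 * qint p i) = C * q ^ i * (q * inverse q) ^ 2 * qint p i"
        by (simp only: power_add power_mult_distrib mult_ac)
      then show ?thesis
        by simp
    qed
    moreover have "Suc i + 1 = i + 2"
      by simp
    ultimately show "opscale (C * q ^ (i + 2)) (F (L 1 i)) = ?g (Suc i) - ?f i"
      by (simp only: opscale_diff_right opscale_opscale diff_Suc_1)
  qed
  also have "\<dots> = (\<Sum>i=1..r. ?g (Suc i)) - (\<Sum>i=1..r. ?f i)"
    by (rule sum_subtractf)
  \<comment> \<open>Both sums are extended to the full range 1..p by terms containing [p] = 0 here
    and [0] = 0 below.\<close>
  also have "(\<Sum>i=1..r. ?f i) = (\<Sum>i=1..p. ?f i)"
  proof -
    have "?f (Suc r) = 0"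
      by (simp only: r [symmetric] qint_p[OF p_pos] mult_zero_right opscale_0)
    then have "(\<Sum>i=1..Suc r. ?f i) = (\<Sum>i=1..r. ?f i)"
      by (subst sum.cl_ivl_Suc) simp
    then show ?thesis
      by (simp only: r)
  qed
  also have "(\<Sum>i=1..r. ?g (Suc i)) = (\<Sum>i=1..p. ?g i)"
  proof -
    have "?g 1 = 0"
      by (simp only: diff_self_eq_0 qint_0 mult_zero_right opscale_0)
    from sum_shift_down[of ?g, OF this, of r] show ?thesis
      by (simp only: r)
  qed
  \<comment> \<open>q [i-1] - [i] = -q^(1-i), which cancels q^i up to one factor q, so all
    coefficients become equal.\<close>
  also have "(\<Sum>i=1..p. ?g i) - (\<Sum>i=1..p. ?f i) = (\<Sum>i=1..p. opscale (- (C * q)) (L 0 i))"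
    unfolding sum_subtractf [symmetric] opscale_diff_left [symmetric]
  proof (intro sum.cong refl arg_cong2[where f = opscale])
    fix i assume "i \<in> {1..p}"
    then obtain j where j: "i = Suc j"
      by (cases i) auto
    show "C * q ^ (i + 1) * qint p (i - 1) - C * q ^ i * qint p i = - (C * q)"
      using qint_add[of p j 1] p2 by (simp add: j qint_1 algebra_simps power_inverse)
  qed
  finally show ?thesis
    by (simp add: opscale_sum)
qed

text \<open>At k = 0 the two q-numbers in the recursion of \<open>E_sum_L\<close> coincide, so
  constant sequences are annihilated.\<close>

lemma E_sum_L_0: "E (\<Sum>i=1..p. L 0 i) = 0"
proof -
  have "E (\<Sum>i=1..p - 0. opscale 1 (L 0 i)) = 0"
    by (subst E_sum_L[OF p_pos]) (simp add: sum.neutral)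
  then show ?thesis
    by simp
qed

lemma top_vector_tau: "top_vector D (tau C \<alpha>)"
proof -
  have "K (L 0 i) = L 0 i" for i
    by (simp add: L_def K_qmon)
  then have "K (tau C \<alpha>) = tau C \<alpha>"
    by (simp add: tau_def act_opscale act_sum carr_sum)
  moreover have "E (F (E (tau C \<alpha>))) = 0"
    by (simp add: FE_tau act_opscale carr_sum E_sum_L_0 del: One_nat_def)
  ultimately show ?thesis
    by (simp add: top_vector_def)
qed

end

section \<open>Nonvanishing of \<beta>\<close>

lemma qxy_nonzero: "qxy m n \<noteq> 0"
  unfolding qxy_def by (metis lookup_single_eq lookup_zero zero_neq_one)

lemma qscale_eq_0_iff: "qscale c u = 0 \<longleftrightarrow> c = 0 \<or> u = 0"
proof
  assume *: "qscale c u = 0"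
  show "c = 0 \<or> u = 0"
  proof (cases "c = 0")
    case False
    have "c * Poly_Mapping.lookup u k = 0" for k
      using * by (metis lookup_qscale lookup_zero)
    then show ?thesis
      using False by (auto intro!: poly_mapping_eqI)
  qed simp
qed auto

lemma dy_pow_qxy:
  "\<exists>c. c \<noteq> 0 \<and> (dy p ^^ b) (qxy m (n + b)) = qscale c (qxy m n)"
proof (induction b arbitrary: n)
  case 0
  show ?case
    by (rule exI[of _ 1]) simp
next
  case (Suc b)
  obtain c where "c \<noteq> 0" "(dy p ^^ b) (qxy m (Suc n + b)) = qscale c (qxy m (Suc n))"
    using Suc by blast
  moreover have "dy p (qscale c (qxy m (Suc n))) =
      qscale (c * qroot p powi (- int m - int (Suc n) + 1)) (qxy m n)"
    by (simp add: dy_def qlinear_scale[OF qlinear_qlinext])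
  ultimately show ?case
    by (intro exI[of _ "c * qroot p powi (- int m - int (Suc n) + 1)"]) simp
qed

lemma dx_pow_qxy_0:
  assumes "a > 0"
  shows "(dx p ^^ a) (qscale c (qxy 0 n)) = 0"
proof -
  obtain a' where a: "a = Suc a'"
    using assms gr0_conv_Suc by blast
  have "dx p (qscale c (qxy 0 n)) = 0"
    by (simp add: dx_def qlinear_scale[OF qlinear_qlinext])
  moreover have "(dx p ^^ a') 0 = 0"
    by (induction a') (simp_all add: qlinear_0[OF qlinear_dx])
  ultimately show ?thesis
    by (simp add: a funpow_swap1)
qed

lemma sum_fun_apply: "(\<Sum>i\<in>A. f i) x = (\<Sum>i\<in>A. f i x)"
  for f :: "'i \<Rightarrow> 'a \<Rightarrow> 'b::comm_monoid_add"
  by (induction A rule: infinite_finite_induct) simp_all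

lemma qmult_qscale_right: "qmult p u (qscale c v) = qscale c (qmult p u v)" for u v
  unfolding qmult_def qlinext_def[of _ u] qlinear_scale[OF qlinear_qlinext]
  by (simp add: qscale_sum mult.commute)

context qdiff_algebra
begin

text \<open>On \<open>y\<^sup>(\<^sup>p\<^sup>-\<^sup>1\<^sup>)\<close> only the summand \<open>y\<^sup>(\<^sup>p\<^sup>-\<^sup>1\<^sup>) \<partial>\<^sub>y\<^sup>p\<^sup>-\<^sup>1\<close> survives.\<close>

lemma sum_L_0_nonzero: "(\<Sum>i=1..p. L 0 i) \<noteq> 0"
proof
  let ?y = "qxy 0 (p - 1)"
  assume *: "(\<Sum>i=1..p. L 0 i) = 0"
  \<comment> \<open>The y-derivatives leave a multiple of a pure power of y, and at least one
    x-derivative follows.\<close>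
  have "L 0 i ?y = 0" if i: "1 \<le> i" "i < p" for i
  proof -
    obtain c where "(dy p ^^ (i - 1)) (qxy 0 (p - i + (i - 1))) = qscale c (qxy 0 (p - i))"
      using dy_pow_qxy by blast
    then have "(dx p ^^ (p - i)) ((dy p ^^ (i - 1)) ?y) = 0"
      using i by (simp add: dx_pow_qxy_0)
    then show ?thesis
      by (simp add: L_def qmon_def qmult_def qlinext_def)
  qed
  then have "(\<Sum>i=1..p - 1. L 0 i ?y) = 0"
    by (intro sum.neutral) auto
  moreover obtain c where c: "c \<noteq> 0" "(dy p ^^ (p - 1)) (qxy 0 (0 + (p - 1))) = qscale c (qxy 0 0)"
    using dy_pow_qxy by blast
  then have "L 0 p ?y = qscale c ?y"
    by (simp add: L_def qmon_def qmult_qscale_right) (simp add: qmult_def)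
  moreover have "(\<Sum>i=1..p. L 0 i ?y) = (\<Sum>i=1..p - 1. L 0 i ?y) + L 0 p ?y"
    using p_pos by (cases p) simp_all
  moreover have "(\<Sum>i=1..p. L 0 i ?y) = 0"
    using * sum_fun_apply[of "L 0" "{1..p}" ?y] by simp
  ultimately have "qscale c ?y = 0"
    by simp
  then show False
    using c(1) by (simp add: qscale_eq_0_iff qxy_nonzero)
qed

lemma FE_tau_nonzero:
  assumes "C \<noteq> 0"
  shows "F (E (tau C \<alpha>)) \<noteq> 0"
  using assms sum_L_0_nonzero vs.scale_eq_0_iff by (simp add: FE_tau)

end

section \<open>The module spanned by the ladder of \<tau>\<close>

theorem mainTheorem5:
  fixes p :: nat and \<alpha> q :: complex and D P :: "qop umod"
    and \<tau> \<beta> :: qop and lam rho :: "nat \<Rightarrow> qop"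
  assumes p: "p \<ge> 2"
    and D: "is_qdiff_module_algebra p D"
    and q: "q = qroot p"
    and \<tau>: "\<tau> = opscale (- (q ^ (p * (p - 1) div 2 + 1)))
           (\<Sum>i=1..p. opscale (acoeff p \<alpha> i) (qmon p (p - i) (i - 1) (p - i) (i - 1)))"
    and lam: "\<And>i. lam i = (actE D ^^ i) \<tau>"
    and rho: "\<And>i. rho i = (actF D ^^ i) \<tau>"
    and \<beta>: "\<beta> = actF D (lam 1)"
    and P: "P = D\<lparr>carr := module.span opscale
           ({\<tau>} \<union> lam ` {1..p - 1} \<union> rho ` {1..p - 1} \<union> {\<beta>})\<rparr>"
  shows "\<beta> = actE D (rho 1) \<and>
    u_submodule D (carr P) \<and>
    projective_cover TYPE('m::ab_group_add) TYPE('n::ab_group_add) p P trivial_umod \<and>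
    (\<forall>Q :: 'r::ab_group_add umod.
       projective_cover TYPE(qop) TYPE('r) p Q trivial_umod \<longrightarrow> umod_isomorphic P Q) \<and>
    (\<forall>i. 1 \<le> i \<and> i \<le> p - 2 \<longrightarrow>
       (\<exists>c. c \<noteq> 0 \<and> actF D (lam (i + 1)) = opscale c (lam i)) \<and>
       (\<exists>c. c \<noteq> 0 \<and> actE D (rho (i + 1)) = opscale c (rho i))) \<and>
    lam 1 = opscale (q ^ (p * (p - 1) div 2))
      (\<Sum>i=1..p - 1. opscale (q ^ (i + 2)) (qmon p (p - i) (i - 1) (p - i - 1) i)) \<and>
    lam (p - 1) = opscale ((- 1) ^ (p - 1) * qfact p (p - 1) * q ^ (p * (p - 1) div 2 + 1))
      (qmon p (p - 1) 0 0 (p - 1)) \<and>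
    rho 1 = opscale (- (q ^ (p * (p - 1) div 2)))
      (\<Sum>i=1..p - 1. opscale (q ^ (i + 1)) (qmon p (i - 1) (p - i) i (p - 1 - i))) \<and>
    rho (p - 1) = opscale (- (qfact p (p - 1) * q ^ (p * (p - 1) div 2 + 2)))
      (qmon p 0 (p - 1) (p - 1) 0) \<and>
    \<beta> = opscale (- (q ^ (p * (p - 1) div 2 + 1)))
      (\<Sum>i=1..p. qmon p (p - i) (i - 1) (p - i) (i - 1))"
proof -
  interpret qdiff_algebra p D
    using p D by (simp add: qdiff_algebra_def)
  define N where "N = p * (p - 1) div 2"
  \<comment> \<open>The formulas for \<open>tau\<close> hold with any constant in place of this
    power of q, and its being nonzero gives \<beta> \<noteq> 0.\<close>
  define C where "C = q ^ N"
  have "C \<noteq> 0"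
    by (simp add: C_def q)
  have Cq: "q ^ (N + 1) = C * qroot p" "q ^ (N + 2) = C * qroot p ^ 2"
    by (simp_all add: C_def q power_add power2_eq_square)
  have \<tau>_eq: "\<tau> = tau C \<alpha>"
    unfolding \<tau> tau_def N_def [symmetric] Cq by (simp add: L_def)
  have top: "top_vector D \<tau>"
    unfolding \<tau>_eq by (rule top_vector_tau)
  have \<beta>_eq: "\<beta> = actF D (actE D \<tau>)"
    by (simp add: \<beta> lam)
  have nz: "\<beta> \<noteq> 0"
    unfolding \<beta>_eq \<tau>_eq using \<open>C \<noteq> 0\<close> by (rule FE_tau_nonzero)
  have ladder: "{\<tau>} \<union> lam ` {1..p - 1} \<union> rho ` {1..p - 1} \<union> {\<beta>} = ladder D \<tau> ` rungs p"
  proof -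
    have l: "lam 0 = \<tau>" "ladder D \<tau> (Inr 0) = \<beta>"
      "\<And>i. ladder D \<tau> (Inl i) = lam i" "\<And>i. i > 0 \<Longrightarrow> ladder D \<tau> (Inr i) = rho i"
      by (simp_all add: \<beta>_eq lam rho ladder_def)
    have "rungs p = insert (Inl 0) (Inl ` {1..p - 1} \<union> Inr ` {1..p - 1} \<union> {Inr 0})"
      using p by (auto simp: rungs_def Plus_def image_iff)
    then have "ladder D \<tau> ` rungs p = insert (ladder D \<tau> (Inl 0))
        ((\<lambda>i. ladder D \<tau> (Inl i)) ` {1..p - 1} \<union> (\<lambda>i. ladder D \<tau> (Inr i)) ` {1..p - 1} \<union> {ladder D \<tau> (Inr 0)})"
      by (simp only: image_insert image_Un image_image image_empty)
    also have "(\<lambda>i. ladder D \<tau> (Inr i)) ` {1..p - 1} = rho ` {1..p - 1}"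
      by (intro image_cong refl l(4)) auto
    finally show ?thesis
      unfolding l(2,3) l(1) by auto
  qed
  have P_eq: "P = D\<lparr>carr := vs.span (ladder D \<tau> ` rungs p)\<rparr>"
    unfolding P ladder scl_D ..
  have sub: "u_submodule D (carr P)"
    unfolding P_eq using u_submodule_span_ladder[OF top] by simp
  have P_module: "u_module p P"
    using u_module_restrict[OF u_submodule_span_ladder[OF top]] by (simp add: P_eq)
  have P_simps: "scl P = scl D" "actE P = actE D" "actF P = actF D" "actK P = actK D" "actKi P = actKi D"
    by (simp_all add: P_eq)
  have ladder_P: "ladder P \<tau> = ladder D \<tau>"
    unfolding ladder_def P_simps ..
  interpret P: ladder_module p P \<tau>
  proof
    show "2 \<le> p" "u_module p P"
      by (fact p, fact P_module)
    have "\<tau> \<in> carr P"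
      unfolding P_eq using p vs.span_base[OF imageI[of "Inl 0" "rungs p" "ladder D \<tau>"]] by simp
    then show "top_vector P \<tau>"
      using top by (simp add: top_vector_def P_simps)
    show "actF P (actE P \<tau>) \<noteq> 0"
      using nz by (simp add: P_simps \<beta>_eq)
    show "carr P = module.span (scl P) (ladder P \<tau> ` rungs p)"
      unfolding ladder_P P_simps by (simp add: P_eq)
  qed
  \<comment> \<open>The types stay polymorphic: one instance is part of the claim, another enters
    the comparison with \<open>Q\<close>.\<close>
  have cover: "projective_cover TYPE('x::ab_group_add) TYPE('y::ab_group_add) p P trivial_umod"
    by (rule P.projective_cover_trivial)
  have neg1: "q ^ (p * (p - 1)) = (- 1) ^ (p - 1)"
    using p by (simp add: q power_mult qroot_power_p)
  \<comment> \<open>[p-1] = [1] = 1. The formulas for the powers of E and F at k = p - 1 produce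
    [p-2]!, while the claim has [p-1]!.\<close>
  have fact: "qfact p (p - 1) = qfact p (p - 2)"
    using qfact_Suc[of "p - 2"] qint_reflect[of 1 p] p
    by (simp add: Suc_diff_Suc numeral_2_eq_2 qint_1)
  have "\<beta> = actE D (rho 1)"
    using EF_eq_FE[of \<tau>] top by (simp add: \<beta>_eq rho top_vector_def)
  moreover have "\<forall>Q :: 'r umod. projective_cover TYPE(qop) TYPE('r) p Q trivial_umod \<longrightarrow> umod_isomorphic P Q"
    using projective_cover_unique[OF p cover] by blast
  moreover have "(\<exists>c. c \<noteq> 0 \<and> actF D (lam (i + 1)) = opscale c (lam i)) \<and>
      (\<exists>c. c \<noteq> 0 \<and> actE D (rho (i + 1)) = opscale c (rho i))" if i: "1 \<le> i" "i \<le> p - 2" for i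
  proof -
    have "- (qint p i * qint p (Suc i)) \<noteq> 0"
      using i p qint_nonzero[of i p] qint_nonzero[of "Suc i" p] by simp
    moreover have "actF D (lam (i + 1)) = opscale (- (qint p i * qint p (Suc i))) (lam i)"
      "actE D (rho (i + 1)) = opscale (- (qint p i * qint p (Suc i))) (rho i)"
      using F_ladder_E_pow[OF top, of i] E_ladder_F_pow[OF top, of i] i
      by (simp_all only: lam rho Suc_eq_plus1 scl_D)
    ultimately show ?thesis
      by blast
  qed
  moreover have "lam 1 = opscale (q ^ N)
      (\<Sum>i=1..p - 1. opscale (q ^ (i + 2)) (qmon p (p - i) (i - 1) (p - i - 1) i))"
  proof -
    have "lam 1 = (\<Sum>i=1..p - 1. opscale (C * q ^ (i + 2)) (L 1 i))"
      unfolding lam \<tau>_eq using E_pow_tau[of 1 C \<alpha>] p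
      by (simp add: q qfact_def power_add power2_eq_square mult_ac)
    then show ?thesis
      by (simp add: opscale_sum C_def L_def)
  qed
  moreover have "lam (p - 1) = opscale ((- 1) ^ (p - 1) * qfact p (p - 1) * q ^ (N + 1)) (qmon p (p - 1) 0 0 (p - 1))"
  proof -
    have "(p - 1)\<^sup>2 + 1 + (p - 1) = p * (p - 1) + 1"
      using p by (cases p) (simp_all add: power2_eq_square)
    then have "q ^ ((p - 1)\<^sup>2 + 1) * q ^ (p - 1) = q ^ (p * (p - 1) + 1)"
      by (simp only: power_add [symmetric])
    moreover have "C * q ^ ((p - 1)\<^sup>2 + 1) * qfact p (p - 2) * q ^ (p - 1) =
        C * (q ^ ((p - 1)\<^sup>2 + 1) * q ^ (p - 1)) * qfact p (p - 2)"
      by (simp only: mult_ac)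
    ultimately have "C * q ^ ((p - 1)\<^sup>2 + 1) * qfact p (p - 2) * q ^ (p - 1) = C * q ^ (p * (p - 1) + 1) * qfact p (p - 1)"
      by (simp only: fact)
    also have "\<dots> = (- 1) ^ (p - 1) * qfact p (p - 1) * q ^ (N + 1)"
      by (simp only: power_add neg1 C_def mult_ac)
    finally have "C * q ^ ((p - 1)\<^sup>2 + 1) * qfact p (p - 2) * q ^ (p - 1) = \<dots>" .
    moreover have "lam (p - 1) = opscale (C * q ^ ((p - 1)\<^sup>2 + 1) * qfact p (p - 2) * q ^ (p - 1)) (L (p - 1) 1)"
      unfolding lam \<tau>_eq using E_pow_tau[of "p - 1" C \<alpha>] p
      by (simp add: q diff_diff_eq numeral_2_eq_2)
    moreover have "L (p - 1) 1 = qmon p (p - 1) 0 0 (p - 1)"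
      by (simp add: L_def)
    ultimately show ?thesis
      by (simp only:)
  qed
  moreover have "rho 1 = opscale (- (q ^ N))
      (\<Sum>i=1..p - 1. opscale (q ^ (i + 1)) (qmon p (i - 1) (p - i) i (p - 1 - i)))"
  proof -
    have "rho 1 = (\<Sum>i=1..p - 1. opscale (- C * q ^ (i + 1)) (R 1 i))"
      unfolding rho \<tau>_eq using F_pow_tau[of 1 C \<alpha>] p
      by (simp add: q qfact_def mult_ac)
    then show ?thesis
      by (simp add: opscale_sum C_def R_def diff_diff_eq)
  qed
  moreover have "rho (p - 1) = opscale (- (qfact p (p - 1) * q ^ (N + 2))) (qmon p 0 (p - 1) (p - 1) 0)"
  proof -
    \<comment> \<open>The additional p in the exponent brings in q^p = -1, the origin of the minus
      sign; the remaining sign (-1)^(p-1) is squared away.\<close>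
    have "(p - 1) * (p - 1 - 1) + 1 + (p - 1) + p = p * (p - 1) + 2"
      using p by (cases p; cases "p - 1") simp_all
    then have *: "q ^ ((p - 1) * (p - 1 - 1) + 1) * q ^ (p - 1) * q ^ p = q ^ (p * (p - 1)) * q ^ 2"
      by (simp only: power_add [symmetric])
    have "q ^ ((p - 1) * (p - 1 - 1) + 1) * q ^ (p - 1) = - ((- 1) ^ (p - 1) * q ^ 2)"
    proof -
      have "q ^ p = - 1"
        using p by (simp add: q qroot_power_p)
      then show ?thesis
        using * unfolding neg1 by (metis minus_minus mult.right_neutral mult_minus_right)
    qed
    moreover have "(- 1) ^ (p - 1) * C * q ^ ((p - 1) * (p - 1 - 1) + 1) * qfact p (p - 1 - 1) * q ^ (p - 1) =
        (- 1) ^ (p - 1) * C * (q ^ ((p - 1) * (p - 1 - 1) + 1) * q ^ (p - 1)) * qfact p (p - 1 - 1)"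
      by (simp only: mult_ac)
    ultimately have "(- 1) ^ (p - 1) * C * q ^ ((p - 1) * (p - 1 - 1) + 1) * qfact p (p - 1 - 1) * q ^ (p - 1) =
        (- 1) ^ (p - 1) * C * - ((- 1) ^ (p - 1) * q ^ 2) * qfact p (p - 1 - 1)"
      by (simp only:)
    also have "\<dots> = - (((- 1) ^ (p - 1) * (- 1) ^ (p - 1)) * (C * q ^ 2 * qfact p (p - 2)))"
      by (simp only: mult_minus_left mult_minus_right mult_ac diff_diff_left one_add_one)
    also have "\<dots> = - (qfact p (p - 1) * q ^ (N + 2))"
      by (simp add: fact[unfolded One_nat_def] C_def power_add power2_eq_square flip: power_mult_distrib)
    finally have "(- 1) ^ (p - 1) * C * q ^ ((p - 1) * (p - 1 - 1) + 1) * qfact p (p - 1 - 1) * q ^ (p - 1) = \<dots>" .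
    moreover have "rho (p - 1) = opscale ((- 1) ^ (p - 1) * C * q ^ ((p - 1) * (p - 1 - 1) + 1) *
        qfact p (p - 1 - 1) * q ^ (p - 1)) (R (p - 1) 1)"
      unfolding rho \<tau>_eq using F_pow_tau[of "p - 1" C \<alpha>] p
      by (simp add: q)
    moreover have "R (p - 1) 1 = qmon p 0 (p - 1) (p - 1) 0"
      by (simp add: R_def)
    ultimately show ?thesis
      by (simp only:)
  qed
  moreover have "\<beta> = opscale (- (q ^ (N + 1))) (\<Sum>i=1..p. qmon p (p - i) (i - 1) (p - i) (i - 1))"
    unfolding \<beta>_eq \<tau>_eq FE_tau Cq by (simp add: L_def)
  ultimately show ?thesis
    using sub cover unfolding N_def by blast
qed

end
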